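(* Let $s\in(\frac45,1]$ and $\sigma\in(\frac{8}{5s},2)$, and fix $\eta>0$. For any $\varepsilon\in(0,1)$, there exists $\alpha=\alpha(\varepsilon)>0$ such that for any initial condition $V_0\in H\cap\mathcal{G}_{\alpha+\eta}^{\sigma,s}$, the stochastic inviscid primitive equations with random diffusion $$dV+\mathcal P Q(V,V)\,dt=\nu A^sV\,dW_t,\qquad V(0)=V_0,$$ have a unique global solution $V\in C([0,\infty);\mathcal{G}_{\eta}^{\sigma,s})$ with probability at least $1-\varepsilon$, provided that $\nu>0$ is sufficiently large.
   Context: Let $\mathbb T^3=\mathbb R^3/\mathbb Z^3$ with points $x=(x',z)$, $x'=(x_1,x_2)$ horizontal, $z$ vertical; $\nabla_h=(\partial_{x_1},\partial_{x_2})$. Unknowns are horizontal vector fields $V=(u,v)$ on $\mathbb T^3$, periodic with period 1 and even in $z$. Fourier series: $f(x)=\sum_{k\in 2\pi\mathbb Z^3}\hat f_k e^{ik\cdot x}$. $A=|\nabla|$ is the Fourier multiplier $\widehat{(Af)}_k=|k|\hat f_k$. For $s\in(0,1]$, $\sigma>0$, $\phi>0$: $\|f\|_{\mathcal G^{\sigma,s}_\phi}=\big(\sum_k(1+e^{2\phi|k|^s}|k|^{2\sigma s})|\hat f_k|^2\big)^{1/2}$, $\mathcal G^{\sigma,s}_\phi=\{f\in H^{\sigma s}:\|f\|_{\mathcal G^{\sigma,s}_\phi}<\infty\}$ (Gevrey class of order $1/s$ and radius $\phi$). $\bar f(x')=\int_0^1 f(x',z)dz$, $\tilde f=f-\bar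 f$. $H=\{f\in L^2(\mathbb T^3):\int f\,dx=0,\ \nabla_h\cdot\bar f=0\}$. Hydrostatic Leray projection $\mathcal P\varphi=\mathcal P_h\bar\varphi+\tilde\varphi$, $\mathcal P_h\bar\varphi=\bar\varphi-\nabla_h\Delta_h^{-1}\nabla_h\cdot\bar\varphi$. $w(U)=-\int_0^z\nabla_h\cdot U(x',\tilde z)d\tilde z$, $Q(U,V)=U\cdot\nabla_hV+w(U)\partial_zV$. $W_t$ is a standard Brownian motion on the canonical Wiener space $(\Omega,\mathcal F,\mathbb P)$. With $\Gamma(t)=e^{-\nu W_tA^s}$, a solution $V$ of the stochastic equation is understood as $V=\Gamma^{-1}U$, where $U$ solves pathwise the random PDE $\partial_tU+\mathcal P\Gamma Q(\Gamma^{-1}U,\Gamma^{-1}U)=-\frac12\nu^2A^{2s}U$, $U(0)=V_0$. *)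

theory Defs
  imports "HOL-Probability.Probability"
begin

text \<open>Fourier representation on the torus T^3 = R^3/Z^3. A field is represented by
its Fourier coefficients indexed by n in Z^3 (wave vector k = 2 pi n).
A horizontal vector field V = (u,v) has coefficients in complex x complex.\<close>

type_synonym idx = "int \<times> int \<times> int"
type_synonym fld = "idx \<Rightarrow> complex \<times> complex"

definition k1 :: "idx \<Rightarrow> real" where "k1 n = 2 * pi * real_of_int (fst n)"
definition k2 :: "idx \<Rightarrow> real" where "k2 n = 2 * pi * real_of_int (fst (snd n))"
definition k3 :: "idx \<Rightarrow> real" where "k3 n = 2 * pi * real_of_int (snd (snd n))"

definition knorm :: "idx \<Rightarrow> real" where
  "knorm n = sqrt ((k1 n)\<^sup>2 + (k2 n)\<^sup>2 + (k3 n)\<^sup>2)"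

definition csq :: "complex \<times> complex \<Rightarrow> real" where
  "csq a = (cmod (fst a))\<^sup>2 + (cmod (snd a))\<^sup>2"

definition cscale :: "complex \<Rightarrow> complex \<times> complex \<Rightarrow> complex \<times> complex" where
  "cscale c a = (c * fst a, c * snd a)"

definition gweight :: "real \<Rightarrow> real \<Rightarrow> real \<Rightarrow> idx \<Rightarrow> real" where
  "gweight \<sigma> s \<phi> n = 1 + exp (2 * \<phi> * knorm n powr s) * knorm n powr (2 * \<sigma> * s)"

definition in_gevrey :: "real \<Rightarrow> real \<Rightarrow> real \<Rightarrow> fld \<Rightarrow> bool" where
  "in_gevrey \<sigma> s \<phi> f \<longleftrightarrow> (\<lambda>n. gweight \<sigma> s \<phi> n * csq (f n)) summable_on UNIV"

definition gnorm :: "real \<Rightarrow> real \<Rightarrow> real \<Rightarrow> fld \<Rightarrow> real" where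
  "gnorm \<sigma> s \<phi> f = sqrt (\<Sum>\<^sub>\<infinity>n. gweight \<sigma> s \<phi> n * csq (f n))"

text \<open>Standing assumptions on unknowns: real-valued (Hermitian coefficients),
even in z.\<close>
definition admissible :: "fld \<Rightarrow> bool" where
  "admissible f \<longleftrightarrow>
     (\<forall>n. f (- n) = (cnj (fst (f n)), cnj (snd (f n)))) \<and>
     (\<forall>a b c. f (a, b, - c) = f (a, b, c))"

text \<open>The space H: L^2, zero mean, barotropic part horizontally divergence free.\<close>
definition in_H :: "fld \<Rightarrow> bool" where
  "in_H f \<longleftrightarrow> (\<lambda>n. csq (f n)) summable_on UNIV \<and> f (0, 0, 0) = (0, 0) \<and>
     (\<forall>a b. complex_of_real (k1 (a, b, 0)) * fst (f (a, b, 0))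
            + complex_of_real (k2 (a, b, 0)) * snd (f (a, b, 0)) = 0)"

definition hdot :: "fld \<Rightarrow> idx \<Rightarrow> complex" where
  "hdot U n = complex_of_real (k1 n) * fst (U n) + complex_of_real (k2 n) * snd (U n)"

text \<open>Fourier coefficients of w(U) = - int_0^z div_h U, for U with div_h of the
vertical mean equal to zero.\<close>
definition wco :: "fld \<Rightarrow> idx \<Rightarrow> complex" where
  "wco U n = (if snd (snd n) \<noteq> 0 then - hdot U n / complex_of_real (k3 n)
     else (\<Sum>\<^sub>\<infinity>m\<in>{m::int. m \<noteq> 0}.
              hdot U (fst n, fst (snd n), m) / complex_of_real (k3 (fst n, fst (snd n), m))))"

text \<open>Q(U,V) = U . grad_h V + w(U) d_z V, coefficientwise (convolution).\<close>
definition Qco :: "fld \<Rightarrow> fld \<Rightarrow> fld" where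
  "Qco U V n = (\<Sum>\<^sub>\<infinity>p. cscale (\<i> * (complex_of_real (k1 (n - p)) * fst (U p)
                                  + complex_of_real (k2 (n - p)) * snd (U p)
                                  + complex_of_real (k3 (n - p)) * wco U p)) (V (n - p)))"

definition Pproj :: "fld \<Rightarrow> fld" where
  "Pproj f n = (if snd (snd n) = 0 \<and> (fst n, fst (snd n)) \<noteq> (0, 0) then
       (let q = ((k1 n)\<^sup>2 + (k2 n)\<^sup>2);
            d = hdot f n / complex_of_real q in
        (fst (f n) - complex_of_real (k1 n) * d, snd (f n) - complex_of_real (k2 n) * d))
     else f n)"

text \<open>Multiplier e^(-c A^s): Gam s c f. Gamma(t) = Gam s (nu W_t).\<close>
definition Gam :: "real \<Rightarrow> real \<Rightarrow> fld \<Rightarrow> fld" where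
  "Gam s c f n = cscale (complex_of_real (exp (- c * knorm n powr s))) (f n)"

text \<open>V is a global solution on the path with Brownian values Wp: V(t) in H, admissible,
V in C([0,oo); G^{sigma,s}_eta), V(0) = V0, and U = Gamma V solves the random PDE
(mode by mode, classically in t >= 0).\<close>
definition is_global_solution ::
  "real \<Rightarrow> real \<Rightarrow> real \<Rightarrow> real \<Rightarrow> (real \<Rightarrow> real) \<Rightarrow> fld \<Rightarrow> (real \<Rightarrow> fld) \<Rightarrow> bool" where
  "is_global_solution \<sigma> s \<eta> \<nu> Wp V0 V \<longleftrightarrow>
     V 0 = V0 \<and>
     (\<forall>t\<ge>0. in_H (V t) \<and> admissible (V t) \<and> in_gevrey \<sigma> s \<eta> (V t)) \<and>
     (\<forall>t0\<ge>0. ((\<lambda>t. gnorm \<sigma> s \<eta> (\<lambda>n. V t n - V t0 n)) \<longlongrightarrow> 0) (at t0 within {0..})) \<and>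
     (let U = (\<lambda>t. Gam s (\<nu> * Wp t) (V t)) in
      \<forall>t\<ge>0. \<forall>n.
        ((\<lambda>\<tau>. U \<tau> n) has_vector_derivative
           (- Pproj (Gam s (\<nu> * Wp t)
                   (Qco (Gam s (- \<nu> * Wp t) (U t)) (Gam s (- \<nu> * Wp t) (U t)))) n
            - cscale (complex_of_real (\<nu>\<^sup>2 / 2 * knorm n powr (2 * s))) (U t n)))
        (at t within {0..}))"

definition brownian_motion :: "'a measure \<Rightarrow> (real \<Rightarrow> 'a \<Rightarrow> real) \<Rightarrow> bool" where
  "brownian_motion M W \<longleftrightarrow> prob_space M \<and>
     (\<forall>t. W t \<in> borel_measurable M) \<and>
     (\<forall>\<omega>\<in>space M. W 0 \<omega> = 0 \<and> continuous_on {0..} (\<lambda>t. W t \<omega>)) \<and>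
     (\<forall>s t. 0 \<le> s \<and> s < t \<longrightarrow>
        distributed M lborel (\<lambda>\<omega>. W t \<omega> - W s \<omega>) (\<lambda>x. ennreal (normal_density 0 (sqrt (t - s)) x))) \<and>
     (\<forall>(ts :: nat \<Rightarrow> real) N. 0 \<le> ts 0 \<and> (\<forall>i<N. ts i < ts (Suc i)) \<longrightarrow>
        prob_space.indep_vars M (\<lambda>_. borel) (\<lambda>i \<omega>. W (ts (Suc i)) \<omega> - W (ts i) \<omega>) {..<N})"

end

theory Submission
  imports Defs
begin

text \<open>Writing \<open>U = \<Gamma> V\<close>, the dissipation \<open>\<nu>\<^sup>2 A\<^sup>2\<^sup>s / 2\<close> created by the random change of
variables lets the Gevrey radius of \<open>U\<close> grow like \<open>\<phi>(t) = \<eta> + \<alpha> / 2 + \<nu>\<^sup>2 t / 4\<close>. On the event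
\<open>\<nu> W\<^sub>t \<le> \<alpha> / 2 + \<nu>\<^sup>2 t / 4\<close> for all \<open>t\<close>, whose probability is at least \<open>1 - exp (- \<alpha> / 4)\<close> for every
\<open>\<nu>\<close>, the radius of \<open>V = \<Gamma>\<^sup>-\<^sup>1 U\<close> stays above \<open>\<eta>\<close>. The spare radius \<open>\<alpha> / 2\<close> of the initial datum pays for
any number of derivatives, so one can work with the supremum of \<open>exp (\<phi> |k|\<^sup>s) |k|\<^sup>7 |U\<^sub>k|\<close> over modes and times.
In this norm the quadratic term is a convolution losing one derivative; the dissipation
recovers it with a factor of order \<open>1 / \<nu>\<^sup>2\<close>, and for large \<open>\<nu>\<close> Duhamel's formula is a contraction.
For uniqueness the weight is frozen at radius \<open>\<nu> W + \<eta> / 2\<close> at a given time, and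
the same estimate with a short time instead of a large \<open>\<nu>\<close> makes two solutions agree a little longer.\<close>

section \<open>Wave vectors\<close>

text \<open>The obstacle is w(U): it costs a horizontal derivative of U while the vertical
  derivative falls on V, so Q differentiates both factors. With the weight |k|^7 each factor of the
  convolution keeps |k|^-6, which is summable over the three-dimensional lattice, and the result is
  again of size |k|^-6: one derivative is missing. The exponential weight passes through because
  |k|^s is subadditive for s \<le> 1. Out of the dissipation \<nu>^2/2 |k|^(2s) the growing radius
  spends \<nu>^2/4 |k|^s; at least \<nu>^2/4 |k| remains. The slope of the barrier is tied to \<nu>
  for a reason: for W itself it is a + b t with a = \<alpha>/(2 \<nu>) and b = \<nu>/4, and in the
  crossing bound exp(-2ab) the parameter \<nu> cancels. So \<alpha> is fixed by \<epsilon> alone,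
  and \<nu> can be enlarged afterwards, depending on V0. A competing solution is only known to be
  continuous into radius \<eta>, not to follow the growing radius, so the existence estimate does
  not compare it with the constructed one; hence a separate local argument.\<close>

lemma continuous_on_infsum:
  fixes f :: "'a \<Rightarrow> 'b::topological_space \<Rightarrow> 'c::banach"
  assumes "\<And>x. x \<in> X \<Longrightarrow> continuous_on S (f x)"
    and "\<And>x t. x \<in> X \<Longrightarrow> t \<in> S \<Longrightarrow> norm (f x t) \<le> B x"
    and "B summable_on X"
  shows "continuous_on S (\<lambda>t. \<Sum>\<^sub>\<infinity>x\<in>X. f x t)"
proof (rule uniform_limit_theorem)
  show "uniform_limit S (\<lambda>Y t. \<Sum>x\<in>Y. f x t) (\<lambda>t. \<Sum>\<^sub>\<infinity>x\<in>X. f x t) (finite_subsets_at_top X)"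
    by (rule Weierstrass_m_test_general) (use assms in auto)
  show "\<forall>\<^sub>F Y in finite_subsets_at_top X. continuous_on S (\<lambda>t. \<Sum>x\<in>Y. f x t)"
    by (rule eventually_finite_subsets_at_top_weakI) (use assms(1) in \<open>auto intro!: continuous_on_sum\<close>)
qed simp

lemma knorm_eq_norm: "knorm n = norm (k1 n, k2 n, k3 n)"
  by (simp add: knorm_def norm_prod_def add.assoc)

lemma knorm_nonneg [simp]: "0 \<le> knorm n"
  by (simp add: knorm_def)

lemma k_zero [simp]: "k1 0 = 0" "k2 0 = 0" "k3 0 = 0"
  by (simp_all add: k1_def k2_def k3_def)

lemma k_uminus [simp]: "k1 (- n) = - k1 n" "k2 (- n) = - k2 n" "k3 (- n) = - k3 n"
  by (simp_all add: k1_def k2_def k3_def)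

lemma k_diff: "k1 (n - p) = k1 n - k1 p" "k2 (n - p) = k2 n - k2 p" "k3 (n - p) = k3 n - k3 p"
  by (simp_all add: k1_def k2_def k3_def algebra_simps)

lemma knorm_zero [simp]: "knorm 0 = 0"
  by (simp add: knorm_def)

lemma knorm_uminus [simp]: "knorm (- n) = knorm n"
  by (simp add: knorm_def)

lemma knorm_triangle_diff: "knorm n \<le> knorm p + knorm (n - p)"
  unfolding knorm_eq_norm k_diff
  using norm_triangle_ineq[of "(k1 p, k2 p, k3 p)" "(k1 n - k1 p, k2 n - k2 p, k3 n - k3 p)"]
  by simp

lemma abs_k_le_knorm: "\<bar>k1 n\<bar> \<le> knorm n" "\<bar>k2 n\<bar> \<le> knorm n" "\<bar>k3 n\<bar> \<le> knorm n"
  unfolding knorm_def by (rule real_le_rsqrt; simp)+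

lemma two_pi_int_ge_1:
  assumes "(a::int) \<noteq> 0" shows "1 \<le> \<bar>2 * pi * real_of_int a\<bar>"
proof -
  have "1 \<le> \<bar>real_of_int a\<bar>" using assms by linarith
  moreover have "1 \<le> 2 * pi" using pi_gt3 by linarith
  ultimately have "1 * 1 \<le> (2 * pi) * \<bar>real_of_int a\<bar>" by (intro mult_mono) auto
  thus ?thesis by (simp add: abs_mult)
qed

lemma abs_k3_ge_1: "k3 n \<noteq> 0 \<Longrightarrow> 1 \<le> \<bar>k3 n\<bar>"
  using two_pi_int_ge_1 unfolding k3_def by auto

lemma knorm_ge_1:
  assumes "n \<noteq> 0" shows "1 \<le> knorm n"
proof -
  obtain a b c where n: "n = (a, b, c)" by (cases n)
  consider "a \<noteq> 0" | "b \<noteq> 0" | "c \<noteq> 0" using assms n by (auto simp: zero_prod_def)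
  thus ?thesis
  proof cases
    case 1 thus ?thesis using two_pi_int_ge_1[of a] abs_k_le_knorm(1)[of n] by (simp add: n k1_def)
  next
    case 2 thus ?thesis using two_pi_int_ge_1[of b] abs_k_le_knorm(2)[of n] by (simp add: n k2_def)
  next
    case 3 thus ?thesis using two_pi_int_ge_1[of c] abs_k_le_knorm(3)[of n] by (simp add: n k3_def)
  qed
qed

lemma knorm_eq_0_iff [simp]: "knorm n = 0 \<longleftrightarrow> n = 0"
  using knorm_ge_1[of n] by (cases "n = 0") auto

text \<open>A number in [0, 1] is at most its \<open>s\<close>-th power when s \<le> 1. Adding this
  for x / (x + y) and y / (x + y), whose sum is 1, gives the claim after multiplication by (x +
  y)^s.\<close>

lemma powr_subadditive:
  fixes x y s :: real
  assumes "0 \<le> x" "0 \<le> y" "0 < s" "s \<le> 1"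
  shows "(x + y) powr s \<le> x powr s + y powr s"
proof (cases "x + y = 0")
  case True thus ?thesis using assms by simp
next
  case False
  hence pos: "0 < x + y" using assms by linarith
  have le: "r / (x + y) \<le> (r / (x + y)) powr s" if "0 \<le> r" "r \<le> x + y" for r
  proof (cases "r = 0")
    case False
    have "(r / (x + y)) powr 1 \<le> (r / (x + y)) powr s"
      by (rule powr_mono') (use that pos assms in auto)
    thus ?thesis using that pos False by simp
  qed simp
  have "1 = x / (x + y) + y / (x + y)" using pos by (simp add: add_divide_distrib[symmetric])
  also have "\<dots> \<le> (x / (x + y)) powr s + (y / (x + y)) powr s"
    by (intro add_mono le) (use assms in auto)
  also have "\<dots> = (x powr s + y powr s) / (x + y) powr s"
    using assms by (simp add: powr_divide add_divide_distrib)
  finally show ?thesis using pos by (simp add: field_simps)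
qed

text \<open>For \<phi> \<ge> 0 this yields exp(- \<phi> |p|^s) exp(- \<phi> |n - p|^s) \<le> exp(-
  \<phi> |n|^s), so a convolution keeps the Gevrey radius of its factors.\<close>

lemma knorm_powr_subadditive:
  assumes "0 < s" "s \<le> 1"
  shows "knorm n powr s \<le> knorm p powr s + knorm (n - p) powr s"
proof -
  have "knorm n powr s \<le> (knorm p + knorm (n - p)) powr s"
    by (rule powr_mono2) (use assms knorm_triangle_diff in auto)
  also have "\<dots> \<le> knorm p powr s + knorm (n - p) powr s"
    by (rule powr_subadditive) (use assms in auto)
  finally show ?thesis .
qed

section \<open>Lattice sums and the convolution of inverse powers\<close>

lemma summable_on_int_inverse_square: "(\<lambda>a::int. 1 / (1 + (real_of_int a)\<^sup>2)) summable_on UNIV"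
proof -
  have nat: "(\<lambda>i::nat. 1 / (1 + (real i)\<^sup>2)) summable_on UNIV"
  proof (subst summable_on_UNIV_nonneg_real_iff)
    show "summable (\<lambda>i::nat. 1 / (1 + (real i)\<^sup>2))"
      by (rule summable_comparison_test'[OF inverse_power_summable[of 2], of 1])
         (auto simp: inverse_eq_divide intro!: divide_left_mono mult_pos_pos add_pos_nonneg)
  qed auto
  have 1: "(\<lambda>a::int. 1 / (1 + (real_of_int a)\<^sup>2)) summable_on range int"
    by (subst summable_on_reindex) (use nat in \<open>simp_all add: o_def\<close>)
  have 2: "(\<lambda>a::int. 1 / (1 + (real_of_int a)\<^sup>2)) summable_on range (\<lambda>i. - int i)"
    by (subst summable_on_reindex) (use nat in \<open>simp_all add: o_def inj_on_def\<close>)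
  have "range int \<union> range (\<lambda>i. - int i) = UNIV"
  proof (rule UNIV_eq_I[symmetric])
    show "x \<in> range int \<union> range (\<lambda>i. - int i)" for x by (cases x rule: int_cases2) auto
  qed
  thus ?thesis using summable_on_union[OF 1 2] by simp
qed

lemma summable_on_prod_mult:
  fixes f :: "'a \<Rightarrow> real" and g :: "'b \<Rightarrow> real"
  assumes "f summable_on UNIV" "g summable_on UNIV" "\<And>a. 0 \<le> f a" "\<And>b. 0 \<le> g b"
  shows "(\<lambda>(a, b). f a * g b) summable_on UNIV"
proof -
  have "(\<lambda>(a, b). f a * g b) summable_on UNIV \<times> UNIV"
    by (rule summable_on_SigmaI[where g = "\<lambda>a. f a * infsum g UNIV"])
       (use assms in \<open>auto intro!: has_sum_cmult_right has_sum_infsum summable_on_cmult_left\<close>)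
  thus ?thesis by simp
qed

text \<open>For p \<noteq> 0 each of 1 + a^2, 1 + b^2, 1 + c^2 is at most 2 |k|^2, so |k|^-6 is
  dominated by 8 times a product of three summable one-dimensional sequences; the exponent 6 is two
  per dimension. The term at p = 0 is 1 / 0 = 0, a convention on which the later sums rely.\<close>

lemma summable_on_knorm_inverse: "(\<lambda>p. 1 / knorm p ^ 6) summable_on UNIV"
proof -
  let ?g = "\<lambda>a::int. 1 / (1 + (real_of_int a)\<^sup>2)"
  have g3: "(\<lambda>(a, bc). ?g a * (case bc of (b, c) \<Rightarrow> ?g b * ?g c)) summable_on UNIV"
    by (intro summable_on_prod_mult summable_on_int_inverse_square) auto
  have le: "1 / knorm p ^ 6 \<le> 8 * (case p of (a, bc) \<Rightarrow> ?g a * (case bc of (b, c) \<Rightarrow> ?g b * ?g c))" for p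
  proof (cases "p = 0")
    case True thus ?thesis by (simp only: True knorm_zero) (simp add: case_prod_beta)
  next
    case False
    obtain a b c where p: "p = (a, b, c)" by (cases p)
    let ?x = "1 + (real_of_int a)\<^sup>2" and ?y = "1 + (real_of_int b)\<^sup>2" and ?z = "1 + (real_of_int c)\<^sup>2"
    have K: "1 \<le> (knorm p)\<^sup>2" using knorm_ge_1[OF False] by simp
    have eq: "(knorm p)\<^sup>2 = (k1 p)\<^sup>2 + (k2 p)\<^sup>2 + (k3 p)\<^sup>2" by (simp add: knorm_def)
    have i: "(real_of_int i)\<^sup>2 \<le> (2 * pi * real_of_int i)\<^sup>2" for i
    proof -
      have "1 \<le> (2 * pi)\<^sup>2" using pi_gt3 by (intro one_le_power) auto
      thus ?thesis by (simp only: power_mult_distrib[of "2*pi"]) (simp add: mult_left_le mult_le_cancel_right1)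
    qed
    have "?x \<le> 2 * (knorm p)\<^sup>2" "?y \<le> 2 * (knorm p)\<^sup>2" "?z \<le> 2 * (knorm p)\<^sup>2"
    proof -
      have "(real_of_int a)\<^sup>2 \<le> (k1 p)\<^sup>2" "(real_of_int b)\<^sup>2 \<le> (k2 p)\<^sup>2" "(real_of_int c)\<^sup>2 \<le> (k3 p)\<^sup>2"
        unfolding p k1_def k2_def k3_def fst_conv snd_conv by (rule i)+
      moreover have "0 \<le> (k1 p)\<^sup>2" "0 \<le> (k2 p)\<^sup>2" "0 \<le> (k3 p)\<^sup>2" by simp_all
      ultimately show "?x \<le> 2 * (knorm p)\<^sup>2" "?y \<le> 2 * (knorm p)\<^sup>2" "?z \<le> 2 * (knorm p)\<^sup>2"
        using K eq by linarith+
    qed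
    hence "?x * (?y * ?z) \<le> (2 * (knorm p)\<^sup>2) * ((2 * (knorm p)\<^sup>2) * (2 * (knorm p)\<^sup>2))"
      by (intro mult_mono) auto
    also have "\<dots> = 8 * knorm p ^ 6" by (simp add: power_numeral_reduce)
    finally have "?x * (?y * ?z) \<le> 8 * knorm p ^ 6" .
    moreover have "0 < ?x * (?y * ?z)" by (intro mult_pos_pos) (auto simp: add_pos_nonneg)
    moreover have "0 < knorm p ^ 6" using False by simp
    ultimately show ?thesis by (simp add: p field_simps)
  qed
  have "(\<lambda>p. 8 * (case p of (a, bc) \<Rightarrow> ?g a * (case bc of (b, c) \<Rightarrow> ?g b * ?g c))) summable_on UNIV"
    using g3 by (intro summable_on_cmult_right) simp
  thus ?thesis by (rule summable_on_comparison_test) (use le in auto)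
qed

definition knorm_sum :: real where "knorm_sum = (\<Sum>\<^sub>\<infinity>p. 1 / knorm p ^ 6)"

lemma knorm_sum_nonneg: "0 \<le> knorm_sum"
  unfolding knorm_sum_def by (rule infsum_nonneg) simp

lemma summable_on_knorm_inverse_shift: "(\<lambda>p. 1 / knorm (n - p) ^ 6) summable_on UNIV"
  and infsum_knorm_inverse_shift: "(\<Sum>\<^sub>\<infinity>p. 1 / knorm (n - p) ^ 6) = knorm_sum"
proof -
  have bij: "bij_betw (\<lambda>p. n - p) UNIV (UNIV :: idx set)"
    by (rule bij_betwI[where g = "\<lambda>p. n - p"]) auto
  show "(\<lambda>p. 1 / knorm (n - p) ^ 6) summable_on UNIV"
    using summable_on_reindex_bij_betw[OF bij, of "\<lambda>p. 1 / knorm p ^ 6"] summable_on_knorm_inverse by simp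
  show "(\<Sum>\<^sub>\<infinity>p. 1 / knorm (n - p) ^ 6) = knorm_sum"
    unfolding knorm_sum_def using infsum_reindex_bij_betw[OF bij, of "\<lambda>p. 1 / knorm p ^ 6"] by simp
qed

text \<open>One of |p| and |n - p| is at least |n| / 2, so |n|^6 \<le> 2^6 (|p|^6 + |n - p|^6);
  dividing by all three sixth powers separates the product into a sum. At p = 0 and p = n the left
  side is 0.\<close>

lemma knorm_conv_le:
  assumes "n \<noteq> 0"
  shows "1 / knorm p ^ 6 * (1 / knorm (n - p) ^ 6)
           \<le> 64 / knorm n ^ 6 * (1 / knorm p ^ 6 + 1 / knorm (n - p) ^ 6)"
proof (cases "p = 0 \<or> p = n")
  case True thus ?thesis by auto
next
  case False
  let ?x = "knorm p" and ?y = "knorm (n - p)" and ?z = "knorm n"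
  have pos: "0 < ?x" "0 < ?y" "0 < ?z" using knorm_ge_1[of p] knorm_ge_1[of "n - p"] knorm_ge_1[of n] False assms by auto
  have "?z \<le> ?x + ?y" by (rule knorm_triangle_diff)
  hence "?z \<le> 2 * max ?x ?y" by linarith
  hence "?z ^ 6 \<le> (2 * max ?x ?y) ^ 6" by (intro power_mono) auto
  also have "\<dots> = 64 * (max ?x ?y) ^ 6" by (simp add: power_mult_distrib)
  also have "(max ?x ?y) ^ 6 \<le> ?x ^ 6 + ?y ^ 6" by (simp add: max_def)
  finally have le: "?z ^ 6 \<le> 64 * (?x ^ 6 + ?y ^ 6)" by simp
  have gen: "1 / a * (1 / b) \<le> 64 / c * (1 / a + 1 / b)"
    if "0 < a" "0 < b" "0 < c" "c \<le> 64 * (a + b)" for a b c :: real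
  proof -
    have "1 / a * (1 / b) * 1 \<le> 1 / a * (1 / b) * (64 * (a + b) / c)"
      using that by (intro mult_left_mono) auto
    also have "\<dots> = 64 / c * (1 / a + 1 / b)" using that by (simp add: field_simps)
    finally show ?thesis by simp
  qed
  show ?thesis by (rule gen) (use pos le in \<open>auto simp only: zero_less_power\<close>)
qed

lemma summable_on_knorm_conv: "(\<lambda>p. 1 / knorm p ^ 6 * (1 / knorm (n - p) ^ 6)) summable_on UNIV"
proof (rule summable_on_comparison_test[OF summable_on_knorm_inverse])
  fix p
  have "1 / knorm (n - p) ^ 6 \<le> 1"
    using one_le_power[OF knorm_ge_1, of "n - p" 6] by (cases "n = p") auto
  thus "1 / knorm p ^ 6 * (1 / knorm (n - p) ^ 6) \<le> 1 / knorm p ^ 6"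
    by (intro mult_left_le) auto
qed auto

lemma infsum_knorm_conv_le:
  assumes "n \<noteq> 0"
  shows "(\<Sum>\<^sub>\<infinity>p. 1 / knorm p ^ 6 * (1 / knorm (n - p) ^ 6)) \<le> 128 * knorm_sum / knorm n ^ 6"
proof -
  have "(\<Sum>\<^sub>\<infinity>p. 1 / knorm p ^ 6 * (1 / knorm (n - p) ^ 6))
      \<le> (\<Sum>\<^sub>\<infinity>p. 64 / knorm n ^ 6 * (1 / knorm p ^ 6 + 1 / knorm (n - p) ^ 6))"
    by (intro infsum_mono summable_on_knorm_conv summable_on_cmult_right summable_on_add
        summable_on_knorm_inverse summable_on_knorm_inverse_shift knorm_conv_le assms)
  also have "\<dots> = 64 / knorm n ^ 6 * (knorm_sum + knorm_sum)"
    unfolding infsum_cmult_right'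
    by (subst infsum_add) (simp_all add: summable_on_knorm_inverse summable_on_knorm_inverse_shift
        infsum_knorm_inverse_shift knorm_sum_def)
  finally show ?thesis by simp
qed

section \<open>The nonlinearity as a convolution\<close>

lemma norm_cscale [simp]: "norm (cscale c a) = cmod c * norm a"
proof -
  have "norm (cscale c a) = sqrt ((cmod c)\<^sup>2 * ((cmod (fst a))\<^sup>2 + (cmod (snd a))\<^sup>2))"
    unfolding cscale_def norm_Pair norm_mult power_mult_distrib distrib_left ..
  thus ?thesis by (simp only: real_sqrt_mult norm_prod_def real_sqrt_abs abs_norm_cancel)
qed

lemma csq_eq_norm: "csq a = (norm a)\<^sup>2"
  by (simp add: csq_def norm_prod_def)

lemma cscale_of_real: "cscale (complex_of_real r) a = r *\<^sub>R a"
  by (cases a) (simp add: cscale_def scaleR_conv_of_real)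

text \<open>The summand of \<^const>\<open>Qco\<close> with \<open>- hdot U p / k3 p\<close> for the vertical velocity at every mode,
also where \<open>k3 p = 0\<close>; this makes it bilinear in the two coefficients.\<close>

definition qterm :: "idx \<Rightarrow> idx \<Rightarrow> complex \<times> complex \<Rightarrow> complex \<times> complex \<Rightarrow> complex \<times> complex" where
  "qterm n p a b = cscale (\<i> * (complex_of_real (k1 (n - p)) * fst a + complex_of_real (k2 (n - p)) * snd a
     - complex_of_real (k3 (n - p)) * ((complex_of_real (k1 p) * fst a + complex_of_real (k2 p) * snd a)
         / complex_of_real (k3 p)))) b"

definition conv :: "fld \<Rightarrow> fld \<Rightarrow> fld" where
  "conv U V n = (\<Sum>\<^sub>\<infinity>p. qterm n p (U p) (V (n - p)))"

lemma qterm_diff_left: "qterm n p (a - a') b = qterm n p a b - qterm n p a' b"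
  by (simp add: qterm_def cscale_def prod_eq_iff divide_inverse algebra_simps)

lemma qterm_diff_right: "qterm n p a (b - b') = qterm n p a b - qterm n p a b'"
  by (simp add: qterm_def cscale_def prod_eq_iff right_diff_distrib)



lemma continuous_on_qterm [continuous_intros]:
  assumes "continuous_on S a" "continuous_on S b"
  shows "continuous_on S (\<lambda>t. qterm n p (a t) (b t))"
proof -
  have "continuous_on S (\<lambda>t. fst (a t))" "continuous_on S (\<lambda>t. snd (a t))"
    "continuous_on S (\<lambda>t. fst (b t))" "continuous_on S (\<lambda>t. snd (b t))"
    using assms by (auto intro: continuous_on_fst continuous_on_snd)
  thus ?thesis unfolding qterm_def cscale_def divide_inverse
    by (intro continuous_on_Pair continuous_on_mult continuous_on_add continuous_on_diff continuous_on_const)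
qed

lemma norm_dot_le:
  fixes a :: "complex \<times> complex"
  assumes "\<bar>x\<bar> \<le> r" "\<bar>y\<bar> \<le> r"
  shows "cmod (complex_of_real x * fst a + complex_of_real y * snd a) \<le> 2 * r * norm a"
proof -
  have "cmod (complex_of_real x * fst a + complex_of_real y * snd a) \<le> \<bar>x\<bar> * cmod (fst a) + \<bar>y\<bar> * cmod (snd a)"
    by (rule order_trans[OF norm_triangle_ineq]) (simp add: norm_mult)
  also have "\<dots> \<le> r * norm a + r * norm a"
    using norm_fst_le[of "fst a" "snd a"] norm_snd_le[of "snd a" "fst a"] assms
    by (intro add_mono mult_mono) auto
  finally show ?thesis by simp
qed

text \<open>The vertical velocity costs |p| and the gradient of the second factor costs |n - p|.
  Division by \<open>k3 p\<close> is harmless: a nonzero \<open>k3 p\<close> is a multiple of 2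
  \<pi>, hence at least 1 in modulus, and otherwise the quotient is 0.\<close>

lemma norm_qterm_le: "norm (qterm n p a b) \<le> 4 * knorm p * knorm (n - p) * norm a * norm b" if "p \<noteq> 0"
proof -
  let ?x = "complex_of_real (k1 (n - p)) * fst a + complex_of_real (k2 (n - p)) * snd a"
  let ?y = "complex_of_real (k1 p) * fst a + complex_of_real (k2 p) * snd a"
  have x: "cmod ?x \<le> 2 * knorm (n - p) * norm a"
    by (rule norm_dot_le) (rule abs_k_le_knorm)+
  have "cmod (?y / complex_of_real (k3 p)) \<le> cmod ?y"
  proof (cases "k3 p = 0")
    case False
    thus ?thesis using abs_k3_ge_1[of p] by (simp add: norm_divide divide_le_eq mult_le_cancel_left1)
  qed simp
  also have "cmod ?y \<le> 2 * knorm p * norm a"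
    by (rule norm_dot_le) (rule abs_k_le_knorm)+
  finally have y: "cmod (?y / complex_of_real (k3 p)) \<le> 2 * knorm p * norm a" .
  have "cmod (complex_of_real (k3 (n - p)) * (?y / complex_of_real (k3 p))) \<le> knorm (n - p) * (2 * knorm p * norm a)"
    unfolding norm_mult norm_of_real by (intro mult_mono y abs_k_le_knorm) auto
  hence "cmod (?x - complex_of_real (k3 (n - p)) * (?y / complex_of_real (k3 p)))
      \<le> 2 * knorm (n - p) * norm a + knorm (n - p) * (2 * knorm p * norm a)"
    using x by (smt (verit) norm_triangle_ineq4)
  also have "\<dots> = 2 * (1 + knorm p) * (knorm (n - p) * norm a)" by (simp add: algebra_simps)
  also have "\<dots> \<le> 4 * knorm p * (knorm (n - p) * norm a)"
    using knorm_ge_1[OF that] by (intro mult_right_mono) auto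
  finally have "cmod (?x - complex_of_real (k3 (n - p)) * (?y / complex_of_real (k3 p))) * norm b
      \<le> 4 * knorm p * (knorm (n - p) * norm a) * norm b"
    by (rule mult_right_mono) simp
  thus ?thesis by (simp add: qterm_def norm_mult mult.assoc)
qed

text \<open>Because of the division by zero at \<open>p = 0\<close> such fields have mean zero.\<close>

definition decays :: "real \<Rightarrow> real \<Rightarrow> real \<Rightarrow> fld \<Rightarrow> bool" where
  "decays s \<phi> R U \<longleftrightarrow> (\<forall>p. norm (U p) \<le> R * exp (- \<phi> * knorm p powr s) / knorm p ^ 7)"

lemma decaysD: "decays s \<phi> R U \<Longrightarrow> norm (U p) \<le> R * exp (- \<phi> * knorm p powr s) / knorm p ^ 7"
  unfolding decays_def by blast

lemma decays_zero: "decays s \<phi> R U \<Longrightarrow> U 0 = 0"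
  using decaysD[of s \<phi> R U 0] by simp

lemma decays_radius_nonneg: "decays s \<phi> R U \<Longrightarrow> 0 \<le> R"
proof -
  assume "decays s \<phi> R U"
  hence "0 \<le> R * exp (- \<phi> * knorm (1, 0, 0) powr s) / knorm (1, 0, 0) ^ 7"
    using decaysD norm_ge_zero order_trans by blast
  moreover have "0 < knorm (1, 0, 0)"
    using knorm_ge_1[of "(1, 0, 0)"] by (simp add: zero_prod_def)
  ultimately show "0 \<le> R" by (simp add: zero_le_divide_iff zero_le_mult_iff)
qed

lemma decays_radius_mono:
  assumes "decays s \<phi> r f" "r \<le> R"
  shows "decays s \<phi> R f"
  unfolding decays_def
proof
  fix p
  have "r * exp (- \<phi> * knorm p powr s) / knorm p ^ 7 \<le> R * exp (- \<phi> * knorm p powr s) / knorm p ^ 7"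
    using assms(2) by (intro divide_right_mono mult_right_mono) auto
  with decaysD[OF assms(1), of p] show "norm (f p) \<le> R * exp (- \<phi> * knorm p powr s) / knorm p ^ 7"
    by linarith
qed

lemma decays_mono:
  assumes "decays s \<phi> R U" "\<psi> \<le> \<phi>"
  shows "decays s \<psi> R U"
  unfolding decays_def
proof
  fix p
  have "R * exp (- \<phi> * knorm p powr s) / knorm p ^ 7 \<le> R * exp (- \<psi> * knorm p powr s) / knorm p ^ 7"
    using decays_radius_nonneg[OF assms(1)] assms(2)
    by (intro divide_right_mono mult_left_mono) (auto intro: mult_right_mono)
  with decaysD[OF assms(1), of p] show "norm (U p) \<le> R * exp (- \<psi> * knorm p powr s) / knorm p ^ 7"
    by linarith
qed

context
  fixes s \<phi> :: real
  assumes s: "0 < s" "s \<le> 1" and \<phi>: "0 \<le> \<phi>"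
begin

text \<open>Each factor gives up one of its seven inverse powers to the derivative that falls on it,
  and the two exponentials merge by subadditivity of |k|^s.\<close>

lemma norm_qterm_decays:
  assumes "decays s \<phi> R U" "decays s \<phi> R' V"
  shows "norm (qterm n p (U p) (V (n - p)))
    \<le> 4 * R * R' * exp (- \<phi> * knorm n powr s) * (1 / knorm p ^ 6 * (1 / knorm (n - p) ^ 6))"
proof (cases "p = 0 \<or> n = p")
  case True
  hence "norm (qterm n p (U p) (V (n - p))) = 0"
    using decays_zero[OF assms(1)] decays_zero[OF assms(2)] by (auto simp: qterm_def)
  thus ?thesis using decays_radius_nonneg[OF assms(1)] decays_radius_nonneg[OF assms(2)] by simp
next
  case False
  let ?x = "knorm p" and ?y = "knorm (n - p)"
  have pos: "0 < ?x" "0 < ?y" using False knorm_ge_1[of p] knorm_ge_1[of "n - p"] by auto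
  have R: "0 \<le> R" "0 \<le> R'" by (rule decays_radius_nonneg, fact)+
  have "norm (qterm n p (U p) (V (n - p))) \<le> 4 * ?x * ?y * norm (U p) * norm (V (n - p))"
    by (rule norm_qterm_le) (use False in auto)
  also have "\<dots> \<le> 4 * ?x * ?y * (R * exp (- \<phi> * ?x powr s) / ?x ^ 7) * (R' * exp (- \<phi> * ?y powr s) / ?y ^ 7)"
    by (intro mult_mono decaysD assms) (use R in auto)
  also have "\<dots> = 4 * R * R' * exp (- \<phi> * (?x powr s + ?y powr s)) * (1 / ?x ^ 6 * (1 / ?y ^ 6))"
  proof -
    have "- \<phi> * (?x powr s + ?y powr s) = - \<phi> * ?x powr s + - \<phi> * ?y powr s" by (simp add: algebra_simps)
    moreover have "?x * (R * a / ?x ^ 7) = R * a / ?x ^ 6" "?y * (R' * a / ?y ^ 7) = R' * a / ?y ^ 6" for a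
      using pos by (simp_all add: field_simps power_numeral_reduce)
    moreover have "4 * ?x * ?y * (R * a / ?x ^ 7) * (R' * b / ?y ^ 7) = 4 * (?x * (R * a / ?x ^ 7)) * (?y * (R' * b / ?y ^ 7))" for a b
      by simp
    ultimately show ?thesis by (simp only: exp_add) simp
  qed
  also have "\<dots> \<le> 4 * R * R' * exp (- \<phi> * knorm n powr s) * (1 / ?x ^ 6 * (1 / ?y ^ 6))"
    using R \<phi> knorm_powr_subadditive[OF s, of n p]
    by (intro mult_mono) (auto intro: mult_left_mono)
  finally show ?thesis .
qed

lemma summable_on_qterm_decays:
  assumes "decays s \<phi> R U" "decays s \<phi> R' V"
  shows "(\<lambda>p. qterm n p (U p) (V (n - p))) summable_on UNIV"
proof -
  have "(\<lambda>p. 4 * R * R' * exp (- \<phi> * knorm n powr s) * (1 / knorm p ^ 6 * (1 / knorm (n - p) ^ 6))) summable_on UNIV"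
    by (intro summable_on_cmult_right summable_on_knorm_conv)
  from abs_summable_summable[OF Infinite_Sum.abs_summable_on_comparison_test'[OF this norm_qterm_decays[OF assms]]]
  show ?thesis .
qed

text \<open>The constant is 4 from the summand times 128 from the lattice sum. The power 6 in place
  of the 7 of \<open>decays\<close> is the derivative that the dissipation has to return.\<close>

lemma norm_conv_decays:
  assumes "decays s \<phi> R U" "decays s \<phi> R' V" "n \<noteq> 0"
  shows "norm (conv U V n) \<le> 512 * knorm_sum * R * R' * exp (- \<phi> * knorm n powr s) / knorm n ^ 6"
proof -
  have R: "0 \<le> R" "0 \<le> R'" by (rule decays_radius_nonneg, fact)+
  have "norm (conv U V n) \<le> (\<Sum>\<^sub>\<infinity>p. 4 * R * R' * exp (- \<phi> * knorm n powr s) * (1 / knorm p ^ 6 * (1 / knorm (n - p) ^ 6)))"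
    unfolding conv_def
    by (rule norm_infsum_le[OF has_sum_infsum[OF summable_on_qterm_decays[OF assms(1,2)]] has_sum_infsum])
       (intro summable_on_cmult_right summable_on_knorm_conv norm_qterm_decays[OF assms(1,2)])+
  also have "\<dots> = 4 * R * R' * exp (- \<phi> * knorm n powr s) * (\<Sum>\<^sub>\<infinity>p. 1 / knorm p ^ 6 * (1 / knorm (n - p) ^ 6))"
    by (rule infsum_cmult_right')
  also have "\<dots> \<le> 4 * R * R' * exp (- \<phi> * knorm n powr s) * (128 * knorm_sum / knorm n ^ 6)"
    by (intro mult_left_mono infsum_knorm_conv_le assms(3)) (use R in auto)
  finally show ?thesis by (simp add: algebra_simps)
qed

text \<open>Bilinearity: Q(U, U) - Q(V, V) = Q(U - V, U) + Q(V, U - V), and each piece contributes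
  the constant 512.\<close>

lemma norm_conv_diff_decays:
  assumes "decays s \<phi> R U" "decays s \<phi> R V" "decays s \<phi> D (\<lambda>n. U n - V n)" "n \<noteq> 0"
  shows "norm (conv U U n - conv V V n) \<le> 1024 * knorm_sum * R * D * exp (- \<phi> * knorm n powr s) / knorm n ^ 6"
proof -
  let ?W = "\<lambda>n. U n - V n"
  have "conv U U n - conv V V n
      = (\<Sum>\<^sub>\<infinity>p. qterm n p (U p) (U (n - p)) - qterm n p (V p) (V (n - p)))"
    unfolding conv_def
    unfolding diff_conv_add_uminus
    by (subst infsum_add) (simp_all add: infsum_uminus summable_on_uminus
        summable_on_qterm_decays[OF assms(1,1)] summable_on_qterm_decays[OF assms(2,2)])
  also have "\<dots> = (\<Sum>\<^sub>\<infinity>p. qterm n p (?W p) (U (n - p)) + qterm n p (V p) (?W (n - p)))"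
    by (intro infsum_cong) (simp add: qterm_diff_left qterm_diff_right)
  also have "\<dots> = conv ?W U n + conv V ?W n"
    unfolding conv_def
    by (rule infsum_add[OF summable_on_qterm_decays[OF assms(3,1)] summable_on_qterm_decays[OF assms(2,3)]])
  finally have "norm (conv U U n - conv V V n) \<le> norm (conv ?W U n) + norm (conv V ?W n)"
    using norm_triangle_ineq by simp
  also have "\<dots> \<le> 512 * knorm_sum * D * R * exp (- \<phi> * knorm n powr s) / knorm n ^ 6
      + 512 * knorm_sum * R * D * exp (- \<phi> * knorm n powr s) / knorm n ^ 6"
    by (intro add_mono norm_conv_decays assms)
  finally show ?thesis by (simp add: algebra_simps)
qed

lemma continuous_on_conv_decays:
  assumes "\<And>t. t \<in> S \<Longrightarrow> decays s \<phi> R (V t)" "\<And>n. continuous_on S (\<lambda>t. V t n)"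
  shows "continuous_on S (\<lambda>t. conv (V t) (V t) n)"
  unfolding conv_def
proof (rule continuous_on_infsum)
  show "norm (qterm n p (V t p) (V t (n - p)))
      \<le> 4 * R * R * exp (- \<phi> * knorm n powr s) * (1 / knorm p ^ 6 * (1 / knorm (n - p) ^ 6))" if "t \<in> S" for p t
    using norm_qterm_decays assms(1) that by blast
  show "(\<lambda>p. 4 * R * R * exp (- \<phi> * knorm n powr s) * (1 / knorm p ^ 6 * (1 / knorm (n - p) ^ 6))) summable_on UNIV"
    by (intro summable_on_cmult_right summable_on_knorm_conv)
qed (intro continuous_intros assms)

end

section \<open>Reality, evenness and incompressibility\<close>

lemma k3_mirror [simp]: "k1 (a, b, - c) = k1 (a, b, c)" "k2 (a, b, - c) = k2 (a, b, c)" "k3 (a, b, - c) = - k3 (a, b, c)"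
  by (simp_all add: k1_def k2_def k3_def)



definition mirror :: "idx \<Rightarrow> idx" where "mirror n = (fst n, fst (snd n), - snd (snd n))"

lemma mirror_mirror [simp]: "mirror (mirror n) = n" and mirror_diff: "mirror (n - p) = mirror n - mirror p"
  and k_mirror [simp]: "k1 (mirror n) = k1 n" "k2 (mirror n) = k2 n" "k3 (mirror n) = - k3 n"
  by (cases n; cases p; simp add: mirror_def k1_def k2_def k3_def)+

lemma knorm_mirror [simp]: "knorm (mirror n) = knorm n"
  by (simp add: knorm_def)

text \<open>A form of \<open>admissible\<close> in terms of two involutions of the index set, n ->
  -n and \<open>mirror\<close>, along which convolution sums can be reindexed.\<close>

definition symmetric :: "fld \<Rightarrow> bool" where
  "symmetric f \<longleftrightarrow> (\<forall>n. f (- n) = (cnj (fst (f n)), cnj (snd (f n)))) \<and> (\<forall>n. f (mirror n) = f n)"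

lemma admissible_iff_symmetric: "admissible f \<longleftrightarrow> symmetric f"
proof -
  have "(\<forall>n. f (mirror n) = f n) \<longleftrightarrow> (\<forall>a b c. f (a, b, - c) = f (a, b, c))"
    by (simp add: mirror_def split_paired_All)
  thus ?thesis by (simp only: admissible_def symmetric_def)
qed

text \<open>For a field that is even in z the vertical velocity is odd, so its barotropic modes vanish;
this agrees with division by zero in the formula below.\<close>

lemma wco_symmetric:
  assumes "symmetric U"
  shows "wco U n = - hdot U n / complex_of_real (k3 n)"
proof (cases "snd (snd n) = 0")
  case True
  define g where "g m = hdot U (fst n, fst (snd n), m) / complex_of_real (k3 (fst n, fst (snd n), m))" for m
  have U: "U (a, b, - c) = U (a, b, c)" for a b c
    using assms unfolding symmetric_def mirror_def by (metis fst_conv snd_conv)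
  have "infsum g {m. m \<noteq> 0} = infsum (\<lambda>m. - g m) {m. m \<noteq> 0}"
    by (rule infsum_reindex_bij_witness[of _ uminus uminus]) (auto simp: g_def hdot_def U)
  hence "infsum g {m. m \<noteq> 0} = 0" by (simp add: infsum_uminus)
  moreover have "wco U n = infsum g {m. m \<noteq> 0}" using True by (simp add: wco_def g_def[abs_def])
  ultimately show ?thesis using True by (simp add: k3_def)
qed (simp add: wco_def)

lemma Qco_symmetric:
  assumes "symmetric U" shows "Qco U V = conv U V"
proof
  fix n
  have "qterm n p (U p) b = cscale (\<i> * (complex_of_real (k1 (n - p)) * fst (U p)
      + complex_of_real (k2 (n - p)) * snd (U p) + complex_of_real (k3 (n - p)) * wco U p)) b" for p b
    unfolding qterm_def hdot_def[of U p, symmetric] wco_symmetric[OF assms] by simp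
  thus "Qco U V n = conv U V n" by (simp only: Qco_def conv_def)
qed

text \<open>Replacing every wave vector by its negative conjugates the symbol i k; under
  \<open>mirror\<close> the vertical wave numbers of both factors change sign, but only their
  quotient enters. Reindexing the sum by either involution gives the two symmetries.\<close>

lemma conv_symmetric:
  assumes "symmetric U" "symmetric V"
  shows "symmetric (conv U V)"
  unfolding symmetric_def
proof (intro conjI allI)
  fix n
  have U: "U (- p) = (cnj (fst (U p)), cnj (snd (U p)))" "U (mirror p) = U p"
    and V: "V (- p) = (cnj (fst (V p)), cnj (snd (V p)))" "V (mirror p) = V p" for p
    using assms unfolding symmetric_def by blast+
  define h :: "complex \<times> complex \<Rightarrow> complex \<times> complex" where "h a = (cnj (fst a), cnj (snd a))" for a
  have h: "bounded_linear h" unfolding h_def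
    by (intro bounded_linear_Pair bounded_linear_compose[OF bounded_linear_cnj] bounded_linear_fst bounded_linear_snd)
  have hh: "h (h a) = a" for a by (simp add: h_def)
  have "conv U V (- n) = (\<Sum>\<^sub>\<infinity>p. h (qterm n p (U p) (V (n - p))))"
    unfolding conv_def
  proof (rule infsum_reindex_bij_witness[of _ uminus uminus])
    fix p
    have "n - - p = - (- n - p)" by simp
    hence "V (n - - p) = h (V (- n - p))" using V(1)[of "- n - p"] by (metis h_def)
    moreover have "k1 (n - - p) = - k1 (- n - p)" "k2 (n - - p) = - k2 (- n - p)" "k3 (n - - p) = - k3 (- n - p)"
      by (simp_all only: \<open>n - - p = - (- n - p)\<close> k_uminus)
    moreover have "U (- p) = h (U p)" by (simp add: U h_def)
    ultimately show "h (qterm n (- p) (U (- p)) (V (n - - p))) = qterm (- n) p (U p) (V (- n - p))"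
      by (simp add: qterm_def cscale_def h_def prod_eq_iff divide_inverse algebra_simps)
  qed auto
  \<comment> \<open>\<open>h\<close> is a bounded linear involution, so a family and its image are
    summable together; if neither is, both sums are 0 and \<open>h\<close> fixes 0.\<close>
  also have "\<dots> = h (conv U V n)"
    unfolding conv_def
    by (intro infsum_bounded_linear_strong h summable_on_bounded_linear_iff[OF h h]) (rule hh)
  finally show "conv U V (- n) = (cnj (fst (conv U V n)), cnj (snd (conv U V n)))" by (simp add: h_def)
  show "conv U V (mirror n) = conv U V n"
    unfolding conv_def
  proof (rule infsum_reindex_bij_witness[of _ mirror mirror])
    fix p
    have e: "n - mirror p = mirror (mirror n - p)" by (simp add: mirror_diff)
    show "qterm n (mirror p) (U (mirror p)) (V (n - mirror p)) = qterm (mirror n) p (U p) (V (mirror n - p))"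
      unfolding qterm_def e by (simp add: U V)
  qed auto
qed

definition div_free :: "fld \<Rightarrow> bool" where
  "div_free f \<longleftrightarrow> (\<forall>n. k3 n = 0 \<longrightarrow> hdot f n = 0)"

lemma in_H_iff: "in_H f \<longleftrightarrow> (\<lambda>n. (norm (f n))\<^sup>2) summable_on UNIV \<and> f 0 = 0 \<and> div_free f"
proof -
  have "k3 n = 0 \<longleftrightarrow> (\<exists>a b. n = (a, b, 0))" for n by (cases n) (auto simp: k3_def)
  hence "div_free f \<longleftrightarrow> (\<forall>a b. hdot f (a, b, 0) = 0)" unfolding div_free_def by metis
  thus ?thesis by (simp add: in_H_def csq_eq_norm hdot_def zero_prod_def)
qed

text \<open>At n = 0 the second factor has wave vector -k(p), and the bracket becomes minus the
  divergence of the full velocity (U, w(U)). It vanishes by the choice of w when \<open>k3 p\<close>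
  is nonzero, and by \<open>div_free\<close> otherwise. Thus the nonlinearity produces no
  mean.\<close>

lemma conv_zero_mode:
  assumes "div_free U" shows "conv U V 0 = 0"
proof -
  have "qterm 0 p (U p) b = 0" for p b
  proof -
    have "qterm 0 p (U p) b
        = cscale (\<i> * (- hdot U p + complex_of_real (k3 p) * (hdot U p / complex_of_real (k3 p)))) b"
      by (simp add: qterm_def hdot_def)
    moreover have "hdot U p = 0" if "k3 p = 0" using assms that unfolding div_free_def by blast
    ultimately show ?thesis by (cases "k3 p = 0") (auto simp: cscale_def zero_prod_def)
  qed
  thus ?thesis unfolding conv_def by simp
qed



section \<open>The hydrostatic Leray projection and the projected nonlinearity\<close>

definition hproj :: "idx \<Rightarrow> complex \<times> complex \<Rightarrow> complex \<times> complex" where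
  "hproj n a = Pproj (\<lambda>_. a) n"

lemma Pproj_eq: "Pproj f n = hproj n (f n)"
  by (simp only: hproj_def Pproj_def hdot_def Let_def)

lemma hproj_alt: "hproj n a = (if k3 n = 0 \<and> (k1 n)\<^sup>2 + (k2 n)\<^sup>2 \<noteq> 0
   then let d = (complex_of_real (k1 n) * fst a + complex_of_real (k2 n) * snd a) / complex_of_real ((k1 n)\<^sup>2 + (k2 n)\<^sup>2)
     in (fst a - complex_of_real (k1 n) * d, snd a - complex_of_real (k2 n) * d) else a)"
proof -
  have a: "snd (snd n) = 0 \<longleftrightarrow> k3 n = 0" by (simp add: k3_def)
  have b: "(fst n, fst (snd n)) \<noteq> (0, 0) \<longleftrightarrow> (k1 n)\<^sup>2 + (k2 n)\<^sup>2 \<noteq> 0"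
    by (simp add: k1_def k2_def sum_power2_eq_zero_iff)
  show ?thesis by (simp only: hproj_def Pproj_def hdot_def Let_def a b)
qed

lemma norm_hproj_le: "norm (hproj n a) \<le> 5 * norm a"
proof (cases "k3 n = 0 \<and> (k1 n)\<^sup>2 + (k2 n)\<^sup>2 \<noteq> 0")
  case True
  let ?q = "(k1 n)\<^sup>2 + (k2 n)\<^sup>2"
  let ?h = "complex_of_real (k1 n) * fst a + complex_of_real (k2 n) * snd a"
  define d where "d = ?h / complex_of_real ?q"
  have q: "0 < ?q" using True by (metis less_eq_real_def sum_power2_ge_zero)
  have "cmod ?h \<le> 2 * sqrt ?q * norm a" by (rule norm_dot_le) (rule real_le_rsqrt; simp)+
  hence d: "cmod d \<le> 2 * sqrt ?q * norm a / ?q"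
    unfolding d_def norm_divide norm_of_real using q by (simp add: divide_right_mono)
  have "norm (complex_of_real (k1 n) * d, complex_of_real (k2 n) * d) = sqrt ?q * cmod d"
    by (simp add: norm_Pair norm_mult power_mult_distrib real_sqrt_mult flip: distrib_right)
  also have "\<dots> \<le> sqrt ?q * (2 * sqrt ?q * norm a / ?q)" by (intro mult_left_mono d) auto
  also have "\<dots> = 2 * norm a * (sqrt ?q * sqrt ?q / ?q)" by (simp add: field_simps)
  also have "sqrt ?q * sqrt ?q / ?q = 1" using q by (metis abs_of_pos divide_self less_irrefl real_sqrt_mult_self)
  finally have "norm (complex_of_real (k1 n) * d, complex_of_real (k2 n) * d) \<le> 2 * norm a" by simp
  moreover have "hproj n a = a - (complex_of_real (k1 n) * d, complex_of_real (k2 n) * d)"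
    unfolding hproj_alt Let_def d_def[symmetric] by (simp only: True simp_thms if_True) (simp add: prod_eq_iff)
  ultimately show ?thesis
    using norm_triangle_ineq4[of a "(complex_of_real (k1 n) * d, complex_of_real (k2 n) * d)"] norm_ge_zero[of a]
    by (simp only:)
next
  case False
  hence "hproj n a = a" by (simp only: hproj_alt if_False)
  thus ?thesis by simp
qed

lemma bounded_linear_hproj: "bounded_linear (hproj n)"
proof (rule bounded_linear_intro)
  show "norm (hproj n a) \<le> norm a * 5" for a using norm_hproj_le[of n a] by simp
qed (auto simp: hproj_alt Let_def prod_eq_iff add_divide_distrib scaleR_conv_of_real algebra_simps)

lemma hproj_div_free: "k3 n = 0 \<Longrightarrow> complex_of_real (k1 n) * fst (hproj n a) + complex_of_real (k2 n) * snd (hproj n a) = 0"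
proof -
  assume k3: "k3 n = 0"
  show ?thesis
  proof (cases "(k1 n)\<^sup>2 + (k2 n)\<^sup>2 = 0")
    case True
    thus ?thesis by (simp add: sum_power2_eq_zero_iff)
  next
    case False
    let ?a = "complex_of_real (k1 n)" and ?b = "complex_of_real (k2 n)"
    have nz: "?a * ?a + ?b * ?b \<noteq> 0"
      using False by (metis of_real_add of_real_eq_0_iff of_real_mult power2_eq_square)
    have gen: "x * (u - x * (h / q)) + y * (v - y * (h / q)) = 0"
      if "q = x * x + y * y" "q \<noteq> 0" "h = x * u + y * v" for x y u v h q :: complex
    proof -
      have "x * (u - x * (h / q)) + y * (v - y * (h / q)) = (x * u + y * v) - (x * x + y * y) * (h / q)"
        by (simp only: algebra_simps)
      also have "\<dots> = h - q * (h / q)" by (simp only: that(1,3))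
      finally show ?thesis using that(2) by simp
    qed
    show ?thesis using False k3
      by (simp only: hproj_alt Let_def if_True simp_thms fst_conv snd_conv)
         (rule gen; use nz in \<open>simp add: power2_eq_square\<close>)
  qed
qed

lemma hproj_mirror [simp]: "hproj (mirror n) a = hproj n a"
  by (simp add: hproj_alt)

lemma hproj_uminus_cnj: "hproj (- n) (cnj (fst a), cnj (snd a)) = (cnj (fst (hproj n a)), cnj (snd (hproj n a)))"
  by (simp add: hproj_alt Let_def divide_inverse algebra_simps)

lemma Gam_eq: "Gam s c f n = exp (- c * knorm n powr s) *\<^sub>R f n"
  by (simp only: Gam_def cscale_of_real)

text \<open>The term P \<Gamma> Q(V, V) of the random equation, written through V = \<Gamma>^-1 U,
  with \<open>c\<close> standing for \<nu> W. Using \<open>conv\<close> for Q is justified on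
  symmetric fields by \<open>Qco_symmetric\<close>.\<close>

definition nonlin :: "real \<Rightarrow> real \<Rightarrow> fld \<Rightarrow> fld" where
  "nonlin s c V = Pproj (Gam s c (conv V V))"

lemma nonlin_eq: "nonlin s c V n = hproj n (exp (- c * knorm n powr s) *\<^sub>R conv V V n)"
  by (simp add: nonlin_def Pproj_eq Gam_eq)

lemma nonlin_symmetric:
  assumes "symmetric V" shows "symmetric (nonlin s c V)"
  unfolding symmetric_def
proof (intro conjI allI)
  fix n
  have c: "conv V V (- n) = (cnj (fst (conv V V n)), cnj (snd (conv V V n)))" "conv V V (mirror n) = conv V V n"
    using conv_symmetric[OF assms assms] unfolding symmetric_def by blast+
  show "nonlin s c V (- n) = (cnj (fst (nonlin s c V n)), cnj (snd (nonlin s c V n)))"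
    unfolding nonlin_eq c hproj_uminus_cnj[symmetric] by (simp add: scaleR_conv_of_real)
  show "nonlin s c V (mirror n) = nonlin s c V n" by (simp add: nonlin_eq c)
qed

lemma nonlin_div_free: "div_free (nonlin s c V)"
  by (simp add: div_free_def hdot_def nonlin_eq hproj_div_free)

lemma nonlin_zero_mode: "div_free V \<Longrightarrow> nonlin s c V 0 = 0"
  by (simp add: nonlin_eq conv_zero_mode hproj_alt)

context
  fixes s c \<phi> :: real
  assumes s: "0 < s" "s \<le> 1" and c\<phi>: "c \<le> \<phi>"
begin

text \<open>\<Gamma>^-1 takes \<open>c\<close> away from the radius \<phi> of U, and the multiplier
  \<Gamma> outside Q gives it back, so the bound is again on the scale of U. The assumption c \<le>
  \<phi> keeps the radius inside the convolution nonnegative; 2560 is 512 times the constant 5 of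
  the projection.\<close>

lemma norm_nonlin_le:
  assumes "decays s (\<phi> - c) R V" "n \<noteq> 0"
  shows "norm (nonlin s c V n) \<le> 2560 * knorm_sum * R * R * exp (- \<phi> * knorm n powr s) / knorm n ^ 6"
proof -
  have "norm (nonlin s c V n) \<le> 5 * (exp (- c * knorm n powr s) * norm (conv V V n))"
    unfolding nonlin_eq by (rule order_trans[OF norm_hproj_le]) simp
  also have "\<dots> \<le> 5 * (exp (- c * knorm n powr s) *
      (512 * knorm_sum * R * R * exp (- (\<phi> - c) * knorm n powr s) / knorm n ^ 6))"
    by (intro mult_left_mono norm_conv_decays[OF s]) (use assms c\<phi> in auto)
  also have "\<dots> = 2560 * knorm_sum * R * R * (exp (- c * knorm n powr s) * exp (- (\<phi> - c) * knorm n powr s)) / knorm n ^ 6"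
    by simp
  also have "exp (- c * knorm n powr s) * exp (- (\<phi> - c) * knorm n powr s) = exp (- \<phi> * knorm n powr s)"
    by (simp add: exp_add[symmetric] algebra_simps)
  finally show ?thesis .
qed

lemma norm_nonlin_diff_le:
  assumes "decays s (\<phi> - c) R V" "decays s (\<phi> - c) R V'" "decays s (\<phi> - c) D (\<lambda>n. V n - V' n)" "n \<noteq> 0"
  shows "norm (nonlin s c V n - nonlin s c V' n)
    \<le> 5120 * knorm_sum * R * D * exp (- \<phi> * knorm n powr s) / knorm n ^ 6"
proof -
  have "nonlin s c V n - nonlin s c V' n = hproj n (exp (- c * knorm n powr s) *\<^sub>R (conv V V n - conv V' V' n))"
    unfolding nonlin_eq
    using linear_diff[OF bounded_linear.linear[OF bounded_linear_hproj]] by (simp add: scaleR_diff_right)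
  hence "norm (nonlin s c V n - nonlin s c V' n) \<le> 5 * (exp (- c * knorm n powr s) * norm (conv V V n - conv V' V' n))"
    using norm_hproj_le[of n "exp (- c * knorm n powr s) *\<^sub>R (conv V V n - conv V' V' n)"] by simp
  also have "\<dots> \<le> 5 * (exp (- c * knorm n powr s) *
      (1024 * knorm_sum * R * D * exp (- (\<phi> - c) * knorm n powr s) / knorm n ^ 6))"
    by (intro mult_left_mono norm_conv_diff_decays[OF s]) (use assms c\<phi> in auto)
  also have "\<dots> = 5120 * knorm_sum * R * D * (exp (- c * knorm n powr s) * exp (- (\<phi> - c) * knorm n powr s)) / knorm n ^ 6"
    by simp
  also have "exp (- c * knorm n powr s) * exp (- (\<phi> - c) * knorm n powr s) = exp (- \<phi> * knorm n powr s)"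
    by (simp add: exp_add[symmetric] algebra_simps)
  finally show ?thesis .
qed

end

lemma continuous_on_nonlin:
  assumes "0 < s" "s \<le> 1" "0 \<le> \<phi>" "\<And>t. t \<in> S \<Longrightarrow> decays s \<phi> R (V t)"
    and "\<And>n. continuous_on S (\<lambda>t. V t n)" "continuous_on S c"
  shows "continuous_on S (\<lambda>t. nonlin s (c t) (V t) n)"
proof -
  have "continuous_on S (\<lambda>t. conv (V t) (V t) n)"
    by (rule continuous_on_conv_decays[OF assms(1-3)]) (use assms(4,5) in blast)+
  thus ?thesis unfolding nonlin_eq
    by (intro bounded_linear.continuous_on[OF bounded_linear_hproj] continuous_on_scaleR
        continuous_on_exp continuous_on_mult continuous_on_minus continuous_on_const assms(6))
qed

section \<open>Uniqueness\<close>

text \<open>After multiplication by the integrating factor exp(l (t - a)) the derivative is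
  dominated by that of an explicit scalar function, and the mean value inequality replaces
  integration of the vector-valued forcing. The last term is the closed form of the convolution of
  exp(-l t) with K exp(-m t).\<close>

lemma duhamel_bound:
  fixes y :: "real \<Rightarrow> 'a::real_normed_vector"
  assumes ab: "a \<le> b"
    and der: "\<And>t. t \<in> {a..b} \<Longrightarrow> (y has_vector_derivative (- N t - l *\<^sub>R y t)) (at t within {a..b})"
    and N: "\<And>t. t \<in> {a..b} \<Longrightarrow> norm (N t) \<le> K * exp (- m * (t - a))"
    and ml: "m < l"
  shows "norm (y b) \<le> exp (- l * (b - a)) * norm (y a)
           + K * (exp (- m * (b - a)) - exp (- l * (b - a))) / (l - m)"
proof (cases "a = b")
  case False
  define f where "f t = exp (l * (t - a)) *\<^sub>R y t" for t
  define g where "g t = K / (l - m) * exp ((l - m) * (t - a))" for t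
  have f': "(f has_vector_derivative (- (exp (l * (t - a)) *\<^sub>R N t))) (at t within {a..b})" if "t \<in> {a..b}" for t
    unfolding f_def using ml
    by (auto intro!: derivative_eq_intros der[OF that] simp: algebra_simps)
  have g': "(g has_vector_derivative (K * exp ((l - m) * (t - a)))) (at t within {a..b})" for t
  proof -
    have "((\<lambda>t. exp ((l - m) * (t - a))) has_real_derivative exp ((l - m) * (t - a)) * (l - m)) (at t within {a..b})"
      by (auto intro!: derivative_eq_intros)
    from DERIV_cmult[OF this, of "K / (l - m)"]
    show ?thesis unfolding g_def has_real_derivative_iff_has_vector_derivative[symmetric] using ml by simp
  qed
  have "norm (f b - f a) \<le> g b - g a"
  proof (rule differentiable_bound_general)
    show "a < b" using ab False by simp
    show "continuous_on {a..b} f" "continuous_on {a..b} g"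
      using f' g' by (meson has_vector_derivative_continuous continuous_on_eq_continuous_within)+
    fix t assume t: "a < t" "t < b"
    show "(f has_vector_derivative (- (exp (l * (t - a)) *\<^sub>R N t))) (at t)"
      using f'[of t] t by (simp add: at_within_Icc_at)
    show "(g has_vector_derivative (K * exp ((l - m) * (t - a)))) (at t)"
      using g'[of t] t by (simp add: at_within_Icc_at)
    have "norm (- (exp (l * (t - a)) *\<^sub>R N t)) \<le> exp (l * (t - a)) * (K * exp (- m * (t - a)))"
      using N[of t] t by simp
    also have "\<dots> = K * (exp (l * (t - a)) * exp (- m * (t - a)))" by simp
    also have "exp (l * (t - a)) * exp (- m * (t - a)) = exp ((l - m) * (t - a))"
      by (simp add: exp_add[symmetric] algebra_simps)
    finally show "norm (- (exp (l * (t - a)) *\<^sub>R N t)) \<le> K * exp ((l - m) * (t - a))" .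
  qed
  hence "norm (f b) \<le> norm (y a) + (g b - g a)"
    using norm_triangle_sub[of "f b" "f a"] by (simp add: f_def)
  hence "exp (- l * (b - a)) * norm (f b) \<le> exp (- l * (b - a)) * (norm (y a) + (g b - g a))"
    by (intro mult_left_mono) auto
  also have "exp (- l * (b - a)) * norm (f b) = norm (y b)"
    by (simp add: f_def exp_minus)
  also have "exp (- l * (b - a)) * (norm (y a) + (g b - g a)) = exp (- l * (b - a)) * norm (y a)
      + K * (exp (- l * (b - a)) * exp ((l - m) * (b - a)) - exp (- l * (b - a))) / (l - m)"
  proof -
    have gen: "e * (Y + (K / q * F - K / q)) = e * Y + K * (e * F - e) / q" for e Y F q :: real
      by (simp add: algebra_simps diff_divide_distrib)
    show ?thesis unfolding g_def using gen by simp
  qed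
  also have "exp (- l * (b - a)) * exp ((l - m) * (b - a)) = exp (- m * (b - a))"
    by (simp add: exp_add[symmetric] algebra_simps)
  finally show ?thesis .
qed simp

text \<open>Since \<open>1 - exp (- x) \<le> x powr \<theta>\<close> for \<open>\<theta> = 1 - 1 / (2 * s)\<close>, the heat semigroup of order \<open>2 * s > 1\<close>
recovers one derivative with a constant that is small for short times.\<close>

lemma short_time_smoothing:
  fixes a c s :: real
  assumes "0 < a" "0 < c" "1/2 < s"
  obtains d where "0 < d"
    "\<And>k h. 1 \<le> k \<Longrightarrow> 0 \<le> h \<Longrightarrow> h \<le> d \<Longrightarrow> k * (1 - exp (- (a * k powr (2 * s)) * h)) / (a * k powr (2 * s)) \<le> c"
proof -
  define \<theta> where "\<theta> = 1 - 1 / (2 * s)"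
  have \<theta>: "0 < \<theta>" "\<theta> \<le> 1" using assms(3) by (auto simp: \<theta>_def field_simps)
  \<comment> \<open>Chosen so that d^\<theta> = c a^(1/(2s)). With l = a k^(2s), the factor
    l^(\<theta> - 1) = a^(-1/(2s)) k^(-1) then cancels both \<open>k\<close> and the power of
    \<open>a\<close>, leaving exactly \<open>c\<close>.\<close>
  define d where "d = (c * a powr (1 / (2 * s))) powr (1 / \<theta>)"
  have d: "0 < d" using assms by (simp add: d_def)
  have d_powr: "d powr \<theta> = c * a powr (1 / (2 * s))"
    using assms \<theta> by (simp add: d_def powr_powr)
  have "k * (1 - exp (- (a * k powr (2 * s)) * h)) / (a * k powr (2 * s)) \<le> c"
    if k: "1 \<le> k" and h: "0 \<le> h" "h \<le> d" for k h
  proof -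
    define l where "l = a * k powr (2 * s)"
    have l: "0 < l" using assms k by (simp add: l_def)
    have "1 - exp (- l * h) \<le> (l * h) powr \<theta>"
    proof (cases "l * h \<le> 1")
      case True
      have "1 - exp (- l * h) \<le> l * h" using exp_ge_add_one_self[of "- l * h"] by simp
      also have "\<dots> \<le> (l * h) powr \<theta>"
      proof (cases "h = 0")
        case False
        hence "(l * h) powr 1 \<le> (l * h) powr \<theta>" using True \<theta> l h by (intro powr_mono') auto
        thus ?thesis using l h by simp
      qed simp
      finally show ?thesis .
    next
      case False
      have "1 - exp (- l * h) \<le> 1" by simp
      also have "\<dots> \<le> (l * h) powr \<theta>" using False \<theta> by (intro ge_one_powr_ge_zero) auto
      finally show ?thesis .
    qed
    also have "\<dots> \<le> (l * d) powr \<theta>" using l h \<theta> by (intro powr_mono2) auto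
    also have "\<dots> = l powr \<theta> * (c * a powr (1 / (2 * s)))" using l d by (simp add: powr_mult d_powr)
    finally have "k * (1 - exp (- l * h)) / l \<le> k * (l powr \<theta> * (c * a powr (1 / (2 * s)))) / l"
      using k l by (intro divide_right_mono mult_left_mono) auto
    also have "\<dots> = c * (k * a powr (1 / (2 * s)) * (l powr \<theta> / l powr 1))" using l by simp
    also have "l powr \<theta> / l powr 1 = l powr (- (1 / (2 * s)))"
      unfolding powr_diff[symmetric] \<theta>_def by simp
    also have "l powr (- (1 / (2 * s))) = a powr (- (1 / (2 * s))) * k powr (- 1)"
      using assms k by (simp add: l_def powr_mult powr_powr)
    also have "k * a powr (1 / (2 * s)) * (a powr (- (1 / (2 * s))) * k powr (- 1)) = 1"
      using assms k by (simp add: powr_minus field_simps)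
    finally show ?thesis by (simp add: l_def)
  qed
  with d show ?thesis by (rule that)
qed

text \<open>One term of the exponential series suffices: with s j \<ge> m, x^m \<le> (x^s)^j, and (c
  x^s)^j / j! \<le> exp(c x^s). This is how spare Gevrey radius buys derivatives.\<close>

lemma power_le_exp_powr:
  fixes c s :: real
  assumes "0 < c" "0 < s"
  obtains C where "0 < C" "\<And>x. 1 \<le> x \<Longrightarrow> x ^ m \<le> C * exp (c * x powr s)"
proof -
  define j where "j = nat \<lceil>real m / s\<rceil>"
  have j: "real m \<le> s * real j"
  proof -
    have "real m / s \<le> real j" unfolding j_def by linarith
    thus ?thesis using assms by (simp add: field_simps)
  qed
  have bound: "x ^ m \<le> fact j / c ^ j * exp (c * x powr s)" if x: "1 \<le> x" for x
  proof -
    have "(c * x powr s) ^ j / fact j \<le> exp (c * x powr s)"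
    proof -
      have "(\<Sum>i<Suc j. (c * x powr s) ^ i /\<^sub>R fact i) \<le> exp (c * x powr s)"
        unfolding exp_def using assms
        by (intro sum_le_suminf summable_exp_generic) auto
      moreover have "(c * x powr s) ^ j /\<^sub>R fact j \<le> (\<Sum>i<Suc j. (c * x powr s) ^ i /\<^sub>R fact i)"
        using assms by (simp add: sum_nonneg)
      ultimately show ?thesis by (simp add: field_simps)
    qed
    hence "(x powr s) ^ j \<le> fact j / c ^ j * exp (c * x powr s)"
      using assms by (simp add: field_simps power_mult_distrib)
    moreover have "x ^ m \<le> (x powr s) ^ j"
    proof -
      have "x ^ m = x powr real m" using x by (simp add: powr_realpow)
      also have "\<dots> \<le> x powr (s * real j)" using x j by (intro powr_mono) auto
      also have "\<dots> = (x powr s) powr real j" by (simp add: powr_powr)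
      also have "\<dots> = (x powr s) ^ j" using x by (simp add: powr_realpow)
      finally show ?thesis .
    qed
    ultimately show ?thesis by linarith
  qed
  show ?thesis by (rule that[of "fact j / c ^ j"]) (use assms bound in auto)
qed

section \<open>From Gevrey norms to pointwise decay of the modes\<close>

lemma gweight_nonneg: "0 \<le> gweight \<sigma> s \<phi> n"
  by (simp add: gweight_def)

text \<open>An infinite sum that does not converge has value 0, so a small \<open>gnorm\<close> of V
  t - V t0 controls the modes only once the difference is known to lie in the Gevrey space.\<close>

lemma in_gevrey_diff:
  assumes "in_gevrey \<sigma> s \<phi> f" "in_gevrey \<sigma> s \<phi> g"
  shows "in_gevrey \<sigma> s \<phi> (\<lambda>n. f n - g n)"
proof -
  have "(\<lambda>n. 2 * (gweight \<sigma> s \<phi> n * csq (f n)) + 2 * (gweight \<sigma> s \<phi> n * csq (g n))) summable_on UNIV"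
    using assms unfolding in_gevrey_def by (intro summable_on_add summable_on_cmult_right)
  thus ?thesis unfolding in_gevrey_def
  proof (rule summable_on_comparison_test)
    fix n
    have "csq (f n - g n) \<le> 2 * csq (f n) + 2 * csq (g n)"
    proof -
      have "(norm (f n - g n))\<^sup>2 \<le> (norm (f n) + norm (g n))\<^sup>2"
        by (intro power_mono norm_triangle_ineq4) auto
      also have "\<dots> \<le> 2 * (norm (f n))\<^sup>2 + 2 * (norm (g n))\<^sup>2"
        using sum_squares_bound[of "norm (f n)" "norm (g n)"] by (simp add: power2_sum)
      finally show ?thesis by (simp add: csq_eq_norm)
    qed
    hence "gweight \<sigma> s \<phi> n * csq (f n - g n) \<le> gweight \<sigma> s \<phi> n * (2 * csq (f n) + 2 * csq (g n))"
      by (rule mult_left_mono) (rule gweight_nonneg)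
    thus "gweight \<sigma> s \<phi> n * csq (f n - g n) \<le> 2 * (gweight \<sigma> s \<phi> n * csq (f n)) + 2 * (gweight \<sigma> s \<phi> n * csq (g n))"
      by (simp add: algebra_simps)
    show "0 \<le> gweight \<sigma> s \<phi> n * csq (f n - g n)" by (simp add: gweight_nonneg csq_eq_norm)
  qed
qed

lemma gevrey_mode_le_gnorm:
  assumes "in_gevrey \<sigma> s \<phi> f" "n \<noteq> 0" "0 \<le> \<sigma> * s"
  shows "exp (\<phi> * knorm n powr s) * norm (f n) \<le> gnorm \<sigma> s \<phi> f"
proof -
  have "(exp (\<phi> * knorm n powr s) * norm (f n))\<^sup>2 = exp (2 * \<phi> * knorm n powr s) * 1 * csq (f n)"
    by (simp add: power_mult_distrib csq_eq_norm power2_eq_square exp_add[symmetric])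
  also have "\<dots> \<le> exp (2 * \<phi> * knorm n powr s) * knorm n powr (2 * \<sigma> * s) * csq (f n)"
    using knorm_ge_1[OF assms(2)] assms(3)
    by (intro mult_right_mono mult_left_mono ge_one_powr_ge_zero) (auto simp: csq_eq_norm)
  also have "\<dots> \<le> gweight \<sigma> s \<phi> n * csq (f n)"
    by (intro mult_right_mono) (auto simp: gweight_def csq_eq_norm)
  also have "\<dots> = (\<Sum>m\<in>{n}. gweight \<sigma> s \<phi> m * csq (f m))" by simp
  also have "\<dots> \<le> (\<Sum>\<^sub>\<infinity>m. gweight \<sigma> s \<phi> m * csq (f m))"
    using assms(1) by (intro finite_sum_le_infsum) (auto simp: in_gevrey_def gweight_nonneg csq_eq_norm)
  finally show ?thesis unfolding gnorm_def by (rule real_le_rsqrt)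
qed

lemma Gam_uminus_Gam: "Gam s (- c) (Gam s c V) = V"
proof
  fix n
  have "exp (- (- c) * knorm n powr s) * exp (- c * knorm n powr s) = 1"
    by (simp add: exp_add[symmetric])
  thus "Gam s (- c) (Gam s c V) n = V n" by (simp add: Gam_eq)
qed

lemma global_solutionD:
  assumes "is_global_solution \<sigma> s \<eta> \<nu> Wp V0 V"
  shows "V 0 = V0"
    and "0 \<le> t \<Longrightarrow> symmetric (V t)" and "0 \<le> t \<Longrightarrow> in_H (V t)" and "0 \<le> t \<Longrightarrow> in_gevrey \<sigma> s \<eta> (V t)"
    and "0 \<le> t \<Longrightarrow> ((\<lambda>\<tau>. gnorm \<sigma> s \<eta> (\<lambda>n. V \<tau> n - V t n)) \<longlongrightarrow> 0) (at t within {0..})"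
    and "0 \<le> t \<Longrightarrow> ((\<lambda>\<tau>. Gam s (\<nu> * Wp \<tau>) (V \<tau>) n) has_vector_derivative
       (- nonlin s (\<nu> * Wp t) (V t) n - (\<nu>\<^sup>2 / 2 * knorm n powr (2 * s)) *\<^sub>R Gam s (\<nu> * Wp t) (V t) n)) (at t within {0..})"
proof -
  show "V 0 = V0" using assms unfolding is_global_solution_def by blast
  show sym: "symmetric (V t)" if "0 \<le> t" for t
    using assms that unfolding is_global_solution_def admissible_iff_symmetric by blast
  show "0 \<le> t \<Longrightarrow> in_H (V t)" "0 \<le> t \<Longrightarrow> in_gevrey \<sigma> s \<eta> (V t)"
    and "0 \<le> t \<Longrightarrow> ((\<lambda>\<tau>. gnorm \<sigma> s \<eta> (\<lambda>n. V \<tau> n - V t n)) \<longlongrightarrow> 0) (at t within {0..})"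
    using assms unfolding is_global_solution_def by blast+
  assume t: "0 \<le> t"
  have "((\<lambda>\<tau>. Gam s (\<nu> * Wp \<tau>) (V \<tau>) n) has_vector_derivative
     - Pproj (Gam s (\<nu> * Wp t) (Qco (Gam s (- \<nu> * Wp t) (Gam s (\<nu> * Wp t) (V t)))
          (Gam s (- \<nu> * Wp t) (Gam s (\<nu> * Wp t) (V t))))) n
     - cscale (complex_of_real (\<nu>\<^sup>2 / 2 * knorm n powr (2 * s))) (Gam s (\<nu> * Wp t) (V t) n)) (at t within {0..})"
    using assms t unfolding is_global_solution_def Let_def by blast
  thus "((\<lambda>\<tau>. Gam s (\<nu> * Wp \<tau>) (V \<tau>) n) has_vector_derivative
       (- nonlin s (\<nu> * Wp t) (V t) n - (\<nu>\<^sup>2 / 2 * knorm n powr (2 * s)) *\<^sub>R Gam s (\<nu> * Wp t) (V t) n)) (at t within {0..})"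
    by (simp only: mult_minus_left Gam_uminus_Gam Qco_symmetric[OF sym[OF t]] nonlin_def cscale_of_real)
qed

text \<open>The loss of radius \<phi> - \<psi> pays for the seven powers of |k|. The constant is the
  same for all fields, so it can be used along a whole time interval.\<close>

lemma exp_bound_imp_decays:
  assumes "\<psi> < \<phi>" "0 < s"
  obtains C where "0 < C"
    "\<And>f G. f 0 = 0 \<Longrightarrow> 0 \<le> G \<Longrightarrow> (\<And>n. n \<noteq> 0 \<Longrightarrow> exp (\<phi> * knorm n powr s) * norm (f n) \<le> G) \<Longrightarrow> decays s \<psi> (G * C) f"
proof -
  obtain C where C: "0 < C" "\<And>x. 1 \<le> x \<Longrightarrow> x ^ 7 \<le> C * exp ((\<phi> - \<psi>) * x powr s)"
    using power_le_exp_powr[of "\<phi> - \<psi>" s 7] assms by auto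
  have "decays s \<psi> (G * C) f"
    if f: "f 0 = 0" and G: "0 \<le> G" and bound: "\<And>n. n \<noteq> 0 \<Longrightarrow> exp (\<phi> * knorm n powr s) * norm (f n) \<le> G" for f G
    unfolding decays_def
  proof
    fix n
    show "norm (f n) \<le> G * C * exp (- \<psi> * knorm n powr s) / knorm n ^ 7"
    proof (cases "n = 0")
      case False
      have *: "norm (f n) \<le> G * exp (- \<phi> * knorm n powr s)"
        using bound[OF False] by (simp add: exp_minus field_simps)
      have pos: "0 < knorm n ^ 7" using knorm_ge_1[OF False] by (intro zero_less_power) linarith
      have "knorm n ^ 7 * exp (- \<phi> * knorm n powr s)
          \<le> C * exp ((\<phi> - \<psi>) * knorm n powr s) * exp (- \<phi> * knorm n powr s)"
        by (intro mult_right_mono C(2) knorm_ge_1 False) auto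
      also have "\<dots> = C * exp (- \<psi> * knorm n powr s)"
        by (simp add: mult.assoc exp_add[symmetric] algebra_simps)
      finally have "exp (- \<phi> * knorm n powr s) \<le> C * exp (- \<psi> * knorm n powr s) / knorm n ^ 7"
        using pos by (simp add: field_simps)
      from mult_left_mono[OF this G] * show ?thesis by (simp add: mult.assoc)
    qed (use f in simp)
  qed
  with C(1) show ?thesis by (rule that)
qed

lemma gnorm_nonneg: "0 \<le> gnorm \<sigma> s \<phi> f"
  unfolding gnorm_def by (simp add: infsum_nonneg gweight_nonneg csq_eq_norm)

text \<open>Continuity in time keeps the Gevrey norm of V t - V t0 below 1 near t0, which bounds the
  weighted modes of V t by 1 plus the norm of V t0; lowering the radius from \<eta> to \<phi> turns
  this into decay. Halving the neighbourhood gives a closed interval.\<close>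

lemma global_solution_locally_decays:
  assumes "is_global_solution \<sigma> s \<eta> \<nu> Wp V0 V" "0 \<le> t0" "0 \<le> \<sigma> * s" "0 < s" "\<phi> < \<eta>"
  obtains d R where "0 < d" "\<And>t. t0 \<le> t \<Longrightarrow> t \<le> t0 + d \<Longrightarrow> decays s \<phi> R (V t)"
proof -
  note sol = global_solutionD[OF assms(1)]
  obtain C where C: "0 < C" "\<And>f G. f 0 = 0 \<Longrightarrow> 0 \<le> G \<Longrightarrow>
      (\<And>n. n \<noteq> 0 \<Longrightarrow> exp (\<eta> * knorm n powr s) * norm (f n) \<le> G) \<Longrightarrow> decays s \<phi> (G * C) f"
    using exp_bound_imp_decays[OF assms(5,4)] by metis
  have "eventually (\<lambda>t. gnorm \<sigma> s \<eta> (\<lambda>n. V t n - V t0 n) < 1) (at t0 within {0..})"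
    using order_tendstoD(2)[OF sol(5)[OF assms(2)], of 1] by simp
  then obtain d where d: "0 < d" "\<And>t. t \<in> {0..} \<Longrightarrow> t \<noteq> t0 \<Longrightarrow> dist t t0 < d \<Longrightarrow> gnorm \<sigma> s \<eta> (\<lambda>n. V t n - V t0 n) < 1"
    unfolding eventually_at by blast
  have "decays s \<phi> ((1 + gnorm \<sigma> s \<eta> (V t0)) * C) (V t)" if t: "t0 \<le> t" "t \<le> t0 + d / 2" for t
  proof (rule C(2))
    show "V t 0 = 0" using sol(3)[of t] t assms(2) by (simp add: in_H_iff)
    show "0 \<le> 1 + gnorm \<sigma> s \<eta> (V t0)" by (simp add: gnorm_nonneg)
    show "exp (\<eta> * knorm n powr s) * norm (V t n) \<le> 1 + gnorm \<sigma> s \<eta> (V t0)" if False: "n \<noteq> 0" for n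
    proof -
      let ?G = "gnorm \<sigma> s \<eta> (V t0)" and ?e = "exp (\<eta> * knorm n powr s)"
      have "?e * norm (V t n - V t0 n) \<le> 1"
      proof (cases "t = t0")
        case False
        have "?e * norm (V t n - V t0 n) \<le> gnorm \<sigma> s \<eta> (\<lambda>n. V t n - V t0 n)"
          by (rule gevrey_mode_le_gnorm) (use sol(4) t assms \<open>n \<noteq> 0\<close> in \<open>auto intro: in_gevrey_diff\<close>)
        also have "\<dots> < 1" using d(2)[of t] t False assms(2) d(1) by (auto simp: dist_real_def)
        finally show ?thesis by simp
      qed simp
      moreover have "?e * norm (V t0 n) \<le> ?G"
        by (rule gevrey_mode_le_gnorm) (use sol(4) assms False in auto)
      moreover have "?e * norm (V t n) \<le> ?e * norm (V t n - V t0 n) + ?e * norm (V t0 n)"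
        using norm_triangle_sub[of "V t n" "V t0 n"] by (simp add: distrib_left[symmetric] add.commute)
      ultimately show ?thesis by linarith
    qed
  qed
  with d(1) show ?thesis by (intro that[of "d / 2" "(1 + gnorm \<sigma> s \<eta> (V t0)) * C"]) simp_all
qed

lemma local_uniqueness:
  assumes V: "is_global_solution \<sigma> s \<eta> \<nu> Wp V0 V" and V': "is_global_solution \<sigma> s \<eta> \<nu> Wp V0 V'"
    and cont: "continuous_on {0..} Wp" and s: "1/2 < s" "s \<le> 1" and pos: "0 < \<sigma>" "0 < \<eta>" "0 < \<nu>"
    and t0: "0 \<le> t0" "V t0 = V' t0"
  obtains d where "0 < d" "\<And>t. t0 \<le> t \<Longrightarrow> t \<le> t0 + d \<Longrightarrow> V t = V' t"
proof -
  have s0: "0 < s" "s \<le> 1" and \<sigma>s: "0 \<le> \<sigma> * s" using s pos by auto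
  have \<eta>': "3 / 4 * \<eta> < \<eta>" using pos by simp
  obtain d1 R1 where d1: "0 < d1" "\<And>t. t0 \<le> t \<Longrightarrow> t \<le> t0 + d1 \<Longrightarrow> decays s (3 / 4 * \<eta>) R1 (V t)"
    using global_solution_locally_decays[OF V t0(1) \<sigma>s s0(1) \<eta>'] by metis
  obtain d2 R2 where d2: "0 < d2" "\<And>t. t0 \<le> t \<Longrightarrow> t \<le> t0 + d2 \<Longrightarrow> decays s (3 / 4 * \<eta>) R2 (V' t)"
    using global_solution_locally_decays[OF V' t0(1) \<sigma>s s0(1) \<eta>'] by metis
  define R where "R = max R1 R2"
  have R: "0 \<le> R" using decays_radius_nonneg[OF d1(2)[of t0]] d1(1) by (simp add: R_def)
  obtain d3 where d3: "0 < d3" "\<And>t. t0 \<le> t \<Longrightarrow> t \<le> t0 + d3 \<Longrightarrow> \<bar>\<nu> * Wp t - \<nu> * Wp t0\<bar> \<le> \<eta> / 4"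
  proof -
    have "continuous_on {0..} (\<lambda>t. \<nu> * Wp t)" by (intro continuous_intros cont)
    then obtain d where d: "0 < d" "\<forall>t\<in>{0..}. dist t t0 < d \<longrightarrow> dist (\<nu> * Wp t) (\<nu> * Wp t0) < \<eta> / 4"
      using t0(1) pos unfolding continuous_on_iff by (metis atLeast_iff divide_pos_pos zero_less_numeral)
    have "\<bar>\<nu> * Wp t - \<nu> * Wp t0\<bar> \<le> \<eta> / 4" if "t0 \<le> t" "t \<le> t0 + d / 2" for t
    proof -
      have "dist t t0 < d" using that d(1) by (simp add: dist_real_def)
      hence "dist (\<nu> * Wp t) (\<nu> * Wp t0) < \<eta> / 4" using d(2) that t0(1) by simp
      thus ?thesis by (simp only: dist_real_def less_imp_le)
    qed
    thus ?thesis using d(1) by (intro that[of "d / 2"]) simp_all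
  qed
  define L where "L = 5120 * knorm_sum * R"
  have L: "0 \<le> L" using R knorm_sum_nonneg by (simp add: L_def)
  define a where "a = \<nu>\<^sup>2 / 2"
  have a: "0 < a" using pos by (simp add: a_def)
  \<comment> \<open>L (1 / (2 (L + 1))) \<le> 1/2 is the contraction factor; the added 1 keeps the
    quotient meaningful for L = 0.\<close>
  obtain d4 where d4: "0 < d4"
    "\<And>k h. 1 \<le> k \<Longrightarrow> 0 \<le> h \<Longrightarrow> h \<le> d4 \<Longrightarrow> k * (1 - exp (- (a * k powr (2 * s)) * h)) / (a * k powr (2 * s)) \<le> 1 / (2 * (L + 1))"
    using short_time_smoothing[OF a, of "1 / (2 * (L + 1))" s] s L by auto
  define d where "d = min (min d1 d2) (min d3 d4)"
  have d: "0 < d" using d1 d2 d3 d4 by (simp add: d_def)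
  define c where "c t = \<nu> * Wp t" for t
  \<comment> \<open>On \<open>I\<close> the noise moves by at most \<eta>/4, so \<psi> - c t stays
    between \<eta>/4 and 3 \<eta>/4: nonnegative, as the estimate of the nonlinearity requires, and
    within the radius at which both solutions decay.\<close>
  define \<psi> where "\<psi> = c t0 + \<eta> / 2"
  define I where "I = {t0..t0 + d}"
  have I: "t0 \<le> t" "t \<le> t0 + d1" "t \<le> t0 + d2" "t \<le> t0 + d3" "t - t0 \<le> d4" "0 \<le> t" if "t \<in> I" for t
    using that t0(1) by (auto simp: I_def d_def)
  have c: "c t \<le> \<psi>" "\<psi> - c t \<le> 3 / 4 * \<eta>" if "t \<in> I" for t
    using d3(2)[OF I(1)[OF that] I(4)[OF that]] pos unfolding \<psi>_def c_def by linarith+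
  have dV: "decays s (\<psi> - c t) R (V t)" "decays s (\<psi> - c t) R (V' t)" if "t \<in> I" for t
  proof -
    show "decays s (\<psi> - c t) R (V t)"
      by (rule decays_mono[OF decays_radius_mono[OF d1(2)[OF I(1)[OF that] I(2)[OF that]]] c(2)[OF that]]) (simp add: R_def)
    show "decays s (\<psi> - c t) R (V' t)"
      by (rule decays_mono[OF decays_radius_mono[OF d2(2)[OF I(1)[OF that] I(3)[OF that]]] c(2)[OF that]]) (simp add: R_def)
  qed
  \<comment> \<open>Any bound D for the difference improves to D / 2. Iterating from 2 R forces the
    difference to vanish, without forming a supremum over modes and times.\<close>
  have step: "\<forall>t\<in>I. decays s (\<psi> - c t) (D / 2) (\<lambda>n. V t n - V' t n)"
    if D: "\<forall>t\<in>I. decays s (\<psi> - c t) D (\<lambda>n. V t n - V' t n)" for D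
  proof (intro ballI, unfold decays_def, rule allI)
    fix t n assume t: "t \<in> I"
    have Dnn: "0 \<le> D" using D t decays_radius_nonneg by blast
    show "norm (V t n - V' t n) \<le> D / 2 * exp (- (\<psi> - c t) * knorm n powr s) / knorm n ^ 7"
    proof (cases "n = 0")
      case True
      thus ?thesis using decays_zero[OF dV(1)[OF t]] decays_zero[OF dV(2)[OF t]] by simp
    next
      case False
      define l where "l = a * knorm n powr (2 * s)"
      have l: "0 < l" using a False by (simp add: l_def)
      define y where "y \<tau> = Gam s (c \<tau>) (V \<tau>) n - Gam s (c \<tau>) (V' \<tau>) n" for \<tau>
      define N where "N \<tau> = nonlin s (c \<tau>) (V \<tau>) n - nonlin s (c \<tau>) (V' \<tau>) n" for \<tau>
      define K where "K = L * D * exp (- \<psi> * knorm n powr s) / knorm n ^ 6"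
      have sub: "\<tau> \<in> I" if "\<tau> \<in> {t0..t}" for \<tau> using that t by (auto simp: I_def)
      \<comment> \<open>The rate m is 0 because the weight is frozen in time: no dissipation is
        spent on a growing radius.\<close>
      have "norm (y t) \<le> exp (- l * (t - t0)) * norm (y t0) + K * (exp (- 0 * (t - t0)) - exp (- l * (t - t0))) / (l - 0)"
      proof (rule duhamel_bound)
        show "t0 \<le> t" by (rule I[OF t])
        fix \<tau> assume \<tau>: "\<tau> \<in> {t0..t}"
        hence "0 \<le> \<tau>" using t0 by simp
        have sol: "((\<lambda>\<tau>. Gam s (c \<tau>) (v \<tau>) n) has_vector_derivative
            (- nonlin s (c \<tau>) (v \<tau>) n - l *\<^sub>R Gam s (c \<tau>) (v \<tau>) n)) (at \<tau> within {t0..t})"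
          if "is_global_solution \<sigma> s \<eta> \<nu> Wp V0 v" for v
          using global_solutionD(6)[OF that \<open>0 \<le> \<tau>\<close>, of n] unfolding c_def l_def a_def
          by (rule has_vector_derivative_within_subset) (use t0(1) in auto)
        show "(y has_vector_derivative - N \<tau> - l *\<^sub>R y \<tau>) (at \<tau> within {t0..t})"
          using has_vector_derivative_diff[OF sol[OF V] sol[OF V']] unfolding y_def N_def
          by (simp add: algebra_simps)
        show "norm (N \<tau>) \<le> K * exp (- 0 * (\<tau> - t0))"
          unfolding N_def K_def L_def
          using norm_nonlin_diff_le[OF s0 c(1)[OF sub[OF \<tau>]] dV[OF sub[OF \<tau>]] _ False, of D] D sub[OF \<tau>]
          by simp
      qed (use l in simp)
      also have "y t0 = 0" by (simp add: y_def t0)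
      finally have "norm (y t) \<le> K * (1 - exp (- l * (t - t0))) / l" by simp
      also have "\<dots> = (L * D * exp (- \<psi> * knorm n powr s) / knorm n ^ 7) * (knorm n * (1 - exp (- l * (t - t0))) / l)"
      proof -
        have "K = L * D * exp (- \<psi> * knorm n powr s) / knorm n ^ 7 * knorm n"
          using False by (simp add: K_def power_numeral_reduce)
        thus ?thesis by (simp only: mult.assoc times_divide_eq_right)
      qed
      also have "\<dots> \<le> (L * D * exp (- \<psi> * knorm n powr s) / knorm n ^ 7) * (1 / (2 * (L + 1)))"
        unfolding l_def
        by (intro mult_left_mono d4 knorm_ge_1 False) (use I[OF t] L Dnn in auto)
      also have "\<dots> = (L / (L + 1)) * (D / 2 * exp (- \<psi> * knorm n powr s) / knorm n ^ 7)"
        using L by (simp add: field_simps)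
      also have "\<dots> \<le> 1 * (D / 2 * exp (- \<psi> * knorm n powr s) / knorm n ^ 7)"
        using L Dnn by (intro mult_right_mono) auto
      finally have y: "norm (y t) \<le> D / 2 * exp (- \<psi> * knorm n powr s) / knorm n ^ 7" by simp
      have "y t = exp (- c t * knorm n powr s) *\<^sub>R (V t n - V' t n)"
        by (simp add: y_def Gam_eq scaleR_diff_right)
      hence "norm (V t n - V' t n) = exp (c t * knorm n powr s) * norm (y t)"
        by (simp add: exp_minus)
      also have "\<dots> \<le> exp (c t * knorm n powr s) * (D / 2 * exp (- \<psi> * knorm n powr s) / knorm n ^ 7)"
        by (intro mult_left_mono y) auto
      also have "\<dots> = D / 2 * (exp (c t * knorm n powr s) * exp (- \<psi> * knorm n powr s)) / knorm n ^ 7" by simp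
      also have "exp (c t * knorm n powr s) * exp (- \<psi> * knorm n powr s) = exp (- (\<psi> - c t) * knorm n powr s)"
        by (simp add: exp_add[symmetric] algebra_simps)
      finally show ?thesis .
    qed
  qed
  have iter: "\<forall>t\<in>I. decays s (\<psi> - c t) (2 * R / 2 ^ j) (\<lambda>n. V t n - V' t n)" for j
  proof (induction j)
    case 0
    show ?case
    proof (intro ballI, unfold decays_def, rule allI)
      fix t n assume t: "t \<in> I"
      show "norm (V t n - V' t n) \<le> 2 * R / 2 ^ 0 * exp (- (\<psi> - c t) * knorm n powr s) / knorm n ^ 7"
        using norm_triangle_ineq4[of "V t n" "V' t n"] decaysD[OF dV(1)[OF t], of n] decaysD[OF dV(2)[OF t], of n]
        by simp
    qed
  next
    case (Suc j)
    from step[OF Suc] show ?case by (simp add: field_simps)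
  qed
  have "V t = V' t" if t: "t \<in> I" for t
  proof
    fix n
    let ?b = "exp (- (\<psi> - c t) * knorm n powr s) / knorm n ^ 7"
    have "(\<lambda>j. 2 * R * ?b * (1 / 2) ^ j) \<longlonglongrightarrow> 2 * R * ?b * 0"
      by (intro tendsto_mult_left LIMSEQ_realpow_zero) auto
    moreover have "norm (V t n - V' t n) \<le> 2 * R * ?b * (1 / 2) ^ j" for j
      using decaysD[OF iter[of j, THEN bspec, OF t], of n] by (simp add: power_divide mult.commute)
    ultimately have "norm (V t n - V' t n) \<le> 2 * R * ?b * 0"
      by (intro LIMSEQ_le_const) auto
    thus "V t n = V' t n" by simp
  qed
  thus ?thesis using that[OF d] by (auto simp: I_def)
qed

text \<open>Let t0 be the infimum of the times of disagreement. Agreement before t0 passes to t0 by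
  continuity and beyond it by the local result, contradicting the infimum.\<close>

lemma global_solution_unique:
  assumes V: "is_global_solution \<sigma> s \<eta> \<nu> Wp V0 V" and V': "is_global_solution \<sigma> s \<eta> \<nu> Wp V0 V'"
    and cont: "continuous_on {0..} Wp" and s: "1/2 < s" "s \<le> 1" and pos: "0 < \<sigma>" "0 < \<eta>" "0 < \<nu>"
    and t: "0 \<le> t"
  shows "V t = V' t"
proof (rule ccontr)
  assume ne: "V t \<noteq> V' t"
  define B where "B = {\<tau>. 0 \<le> \<tau> \<and> V \<tau> \<noteq> V' \<tau>}"
  have B: "B \<noteq> {}" "bdd_below B" using t ne by (auto simp: B_def intro!: bdd_belowI[of _ 0])
  define t0 where "t0 = Inf B"
  have t0: "0 \<le> t0" unfolding t0_def using B by (intro cInf_greatest) (auto simp: B_def)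
  have before: "V \<tau> = V' \<tau>" if "0 \<le> \<tau>" "\<tau> < t0" for \<tau>
    using that cInf_lower[OF _ B(2), of \<tau>] unfolding t0_def B_def by force
  have "V t0 = V' t0"
  proof (cases "t0 = 0")
    case True
    thus ?thesis using global_solutionD(1)[OF V] global_solutionD(1)[OF V'] by simp
  next
    case False
    hence closure: "closure {0..<t0} = {0..t0}" using t0 by (intro closure_atLeastLessThan) auto
    show ?thesis
    proof
      fix n
      \<comment> \<open>The equation makes each mode of \<Gamma> V differentiable, hence continuous
        in time; the limit is taken there and the positive factor of \<Gamma> is divided out at
        t0.\<close>
      define y where "y \<tau> = Gam s (\<nu> * Wp \<tau>) (V \<tau>) n - Gam s (\<nu> * Wp \<tau>) (V' \<tau>) n" for \<tau>
      have "continuous_on {0..} (\<lambda>\<tau>. Gam s (\<nu> * Wp \<tau>) (v \<tau>) n)" if "is_global_solution \<sigma> s \<eta> \<nu> Wp V0 v" for v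
        unfolding continuous_on_eq_continuous_within
        using has_vector_derivative_continuous[OF global_solutionD(6)[OF that]] by simp
      hence "continuous_on {0..} y" unfolding y_def using V V' by (intro continuous_on_diff) auto
      hence "continuous_on (closure {0..<t0}) y" unfolding closure by (rule continuous_on_subset) auto
      moreover have "y \<tau> = 0" if "\<tau> \<in> {0..<t0}" for \<tau> using before that by (simp add: y_def)
      ultimately have "y t0 = 0"
        by (rule continuous_constant_on_closure) (use closure t0 in auto)
      thus "V t0 n = V' t0 n" by (simp add: y_def Gam_eq)
    qed
  qed
  then obtain d where d: "0 < d" "\<And>\<tau>. t0 \<le> \<tau> \<Longrightarrow> \<tau> \<le> t0 + d \<Longrightarrow> V \<tau> = V' \<tau>"
    using local_uniqueness[OF V V' cont s pos t0] by blast
  have "t0 + d \<le> Inf B"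
  proof (rule cInf_greatest[OF B(1)])
    fix \<tau> assume "\<tau> \<in> B"
    thus "t0 + d \<le> \<tau>" using before[of \<tau>] d(2)[of \<tau>] unfolding B_def by force
  qed
  thus False using d(1) unfolding t0_def by simp
qed

section \<open>Existence on a path below a line\<close>

lemma decays_summable:
  assumes "decays s \<phi> R f" "0 \<le> \<phi>"
  shows "(\<lambda>n. (norm (f n))\<^sup>2) summable_on UNIV"
proof (rule summable_on_comparison_test)
  show "(\<lambda>n. R\<^sup>2 * (1 / knorm n ^ 6)) summable_on UNIV"
    by (intro summable_on_cmult_right summable_on_knorm_inverse)
  fix n
  have R: "0 \<le> R" by (rule decays_radius_nonneg) fact
  show "(norm (f n))\<^sup>2 \<le> R\<^sup>2 * (1 / knorm n ^ 6)"
  proof (cases "n = 0")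
    case True thus ?thesis using decays_zero[OF assms(1)] by simp
  next
    case False
    have "norm (f n) \<le> R * exp (- \<phi> * knorm n powr s) / knorm n ^ 7" by (rule decaysD) fact
    also have "\<dots> \<le> R * 1 / knorm n ^ 3"
      using R assms(2) knorm_ge_1[OF False]
      by (intro frac_le mult_left_mono mult_nonneg_nonneg power_increasing) auto
    finally have "(norm (f n))\<^sup>2 \<le> (R / knorm n ^ 3)\<^sup>2" by (intro power_mono) auto
    thus ?thesis by (simp add: power_divide)
  qed
qed simp

text \<open>Since 2 \<sigma> s \<le> 4, the squared decay of order 14 leaves at least order 10, more
  than the summable order 6. Polynomial decay alone thus pays for the Sobolev factor, and the radius
  \<phi> is kept. The bound depends on the field only through R, so it also serves as a majorant in
  time.\<close>

lemma gweight_decays_le: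
  assumes "decays s \<phi> R f" "0 \<le> \<sigma> * s" "\<sigma> * s \<le> 2"
    and "0 \<le> \<phi>"
  shows "gweight \<sigma> s \<phi> n * csq (f n) \<le> 2 * R\<^sup>2 * (1 / knorm n ^ 6)"
proof (cases "n = 0")
  case True thus ?thesis using decays_zero[OF assms(1)] by (simp add: csq_eq_norm)
next
  case False
  let ?k = "knorm n"
  have k: "1 \<le> ?k" by (rule knorm_ge_1) fact
  have R: "0 \<le> R" by (rule decays_radius_nonneg) fact
  have "exp (\<phi> * ?k powr s) * norm (f n) \<le> exp (\<phi> * ?k powr s) * (R * exp (- \<phi> * ?k powr s) / ?k ^ 7)"
    by (intro mult_left_mono decaysD assms) auto
  also have "\<dots> = R / ?k ^ 7" by (simp add: exp_minus)
  finally have "(exp (\<phi> * ?k powr s) * norm (f n))\<^sup>2 \<le> (R / ?k ^ 7)\<^sup>2" by (intro power_mono) auto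
  moreover have "(exp (\<phi> * ?k powr s))\<^sup>2 = exp (2 * \<phi> * ?k powr s)"
    by (simp add: exp_double[symmetric] mult.assoc)
  ultimately have 1: "exp (2 * \<phi> * ?k powr s) * csq (f n) \<le> R\<^sup>2 / ?k ^ 14"
    by (simp add: power_mult_distrib csq_eq_norm power_divide)
  have "?k powr (2 * \<sigma> * s) \<le> ?k powr 4"
    using assms k by (intro powr_mono) auto
  hence 2: "?k powr (2 * \<sigma> * s) \<le> ?k ^ 4" using k by (simp add: powr_numeral)
  have "?k powr (2 * \<sigma> * s) * (exp (2 * \<phi> * ?k powr s) * csq (f n)) \<le> ?k ^ 4 * (R\<^sup>2 / ?k ^ 14)"
    using 1 2 by (intro mult_mono) (auto simp: csq_eq_norm)
  also have "?k ^ 14 = ?k ^ 4 * ?k ^ 10" by (simp add: power_add[symmetric])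
  also have "?k ^ 4 * (R\<^sup>2 / (?k ^ 4 * ?k ^ 10)) = R\<^sup>2 / ?k ^ 10"
  proof -
    have "a * (b / (a * c)) = b / c" if "a \<noteq> 0" for a b c :: real using that by simp
    thus ?thesis using False by (metis knorm_eq_0_iff power_eq_0_iff)
  qed
  also have "\<dots> \<le> R\<^sup>2 / ?k ^ 6"
    using k by (intro divide_left_mono power_increasing mult_pos_pos zero_less_power) auto
  finally have "exp (2 * \<phi> * ?k powr s) * ?k powr (2 * \<sigma> * s) * csq (f n) \<le> R\<^sup>2 / ?k ^ 6"
    by (simp only: mult.assoc mult.left_commute)
  moreover have "csq (f n) \<le> R\<^sup>2 / ?k ^ 6"
  proof -
    have "1 * csq (f n) \<le> exp (2 * \<phi> * ?k powr s) * csq (f n)"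
      using assms(4) by (intro mult_right_mono) (auto simp: csq_eq_norm)
    also have "\<dots> \<le> R\<^sup>2 / ?k ^ 14" by (rule 1)
    also have "\<dots> \<le> R\<^sup>2 / ?k ^ 6"
      using k by (intro divide_left_mono power_increasing mult_pos_pos zero_less_power) auto
    finally show ?thesis by simp
  qed
  ultimately show ?thesis by (simp add: gweight_def distrib_right)
qed

lemma decays_in_gevrey:
  assumes "decays s \<phi> R f" "0 \<le> \<phi>" "0 \<le> \<sigma> * s" "\<sigma> * s \<le> 2"
  shows "in_gevrey \<sigma> s \<phi> f"
  unfolding in_gevrey_def
  by (rule summable_on_comparison_test[OF _ gweight_decays_le[OF assms(1,3,4,2)]])
     (simp_all only: summable_on_cmult_right summable_on_knorm_inverse gweight_nonneg csq_eq_norm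
       mult_nonneg_nonneg zero_le_power2)

text \<open>For \<open>\<nu>\<^sup>2 / 4\<close> as growth rate of the radius half of the dissipation is left over; as \<open>2 * s \<ge> 1\<close>,
it absorbs the derivative lost in the nonlinearity.\<close>

lemma duhamel_decay:
  fixes y :: "real \<Rightarrow> complex \<times> complex"
  assumes n: "n \<noteq> 0" and t: "0 \<le> t" and s: "1/2 \<le> s" and \<nu>: "0 < \<nu>"
    and der: "\<And>\<tau>. \<tau> \<in> {0..t} \<Longrightarrow>
      (y has_vector_derivative (- N \<tau> - (\<nu>\<^sup>2 / 2 * knorm n powr (2 * s)) *\<^sub>R y \<tau>)) (at \<tau> within {0..})"
    and y0: "norm (y 0) \<le> A * exp (- \<rho> * knorm n powr s) / knorm n ^ 7"
    and N: "\<And>\<tau>. \<tau> \<in> {0..t} \<Longrightarrow> norm (N \<tau>) \<le> B * exp (- (\<rho> + \<nu>\<^sup>2 / 4 * \<tau>) * knorm n powr s) / knorm n ^ 6"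
  shows "norm (y t) \<le> (A + 4 * B / \<nu>\<^sup>2) * exp (- (\<rho> + \<nu>\<^sup>2 / 4 * t) * knorm n powr s) / knorm n ^ 7"
proof -
  define k where "k = knorm n"
  define l where "l = \<nu>\<^sup>2 / 2 * k powr (2 * s)"
  define m where "m = \<nu>\<^sup>2 / 4 * k powr s"
  define e where "e = exp (- \<rho> * k powr s)"
  have k: "1 \<le> k" unfolding k_def by (rule knorm_ge_1) fact
  have \<nu>2: "0 < \<nu>\<^sup>2" using \<nu> by simp
  have "k powr s \<le> k powr (2 * s)" using k s by (intro powr_mono) auto
  hence m: "m \<le> \<nu>\<^sup>2 / 4 * k powr (2 * s)" unfolding m_def using \<nu>2 by (intro mult_left_mono) auto
  have "k powr 1 \<le> k powr (2 * s)" using k s by (intro powr_mono) auto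
  hence k2s: "k \<le> k powr (2 * s)" using k by simp
  have lm: "\<nu>\<^sup>2 / 4 * k \<le> l - m"
  proof -
    have "\<nu>\<^sup>2 / 4 * k \<le> \<nu>\<^sup>2 / 4 * k powr (2 * s)" using k2s \<nu>2 by (intro mult_left_mono) auto
    thus ?thesis using m unfolding l_def by linarith
  qed
  have pos: "0 < \<nu>\<^sup>2 / 4 * k" using k \<nu>2 by simp
  hence ml: "m < l" using lm by linarith
  have B: "0 \<le> B"
  proof -
    have "0 \<le> B * exp (- (\<rho> + \<nu>\<^sup>2 / 4 * 0) * knorm n powr s) / knorm n ^ 6"
      using N[of 0] t norm_ge_zero order_trans by (metis atLeastAtMost_iff order_refl)
    thus ?thesis using n by (simp add: zero_le_divide_iff zero_le_mult_iff)
  qed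
  have split: "exp (- (\<rho> + \<nu>\<^sup>2 / 4 * \<tau>) * k powr s) = e * exp (- m * \<tau>)" for \<tau>
    by (simp add: e_def m_def exp_add[symmetric] algebra_simps)
  have "norm (y t) \<le> exp (- l * (t - 0)) * norm (y 0)
      + (B * e / k ^ 6) * (exp (- m * (t - 0)) - exp (- l * (t - 0))) / (l - m)"
  proof (rule duhamel_bound[OF t])
    fix \<tau> assume \<tau>: "\<tau> \<in> {0..t}"
    show "(y has_vector_derivative - N \<tau> - l *\<^sub>R y \<tau>) (at \<tau> within {0..t})"
      using der[OF \<tau>] unfolding l_def k_def by (rule has_vector_derivative_within_subset) auto
    show "norm (N \<tau>) \<le> B * e / k ^ 6 * exp (- m * (\<tau> - 0))"
      using N[OF \<tau>] split[of \<tau>] by (simp add: k_def mult.assoc)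
  qed (rule ml)
  also have "\<dots> \<le> exp (- m * t) * (A * e / k ^ 7) + (B * e / k ^ 6) * exp (- m * t) / (\<nu>\<^sup>2 / 4 * k)"
  proof (intro add_mono)
    show "exp (- l * (t - 0)) * norm (y 0) \<le> exp (- m * t) * (A * e / k ^ 7)"
      using ml t y0 by (intro mult_mono) (auto simp: e_def k_def intro: mult_right_mono)
    show "B * e / k ^ 6 * (exp (- m * (t - 0)) - exp (- l * (t - 0))) / (l - m)
        \<le> B * e / k ^ 6 * exp (- m * t) / (\<nu>\<^sup>2 / 4 * k)"
      by (intro frac_le lm pos mult_left_mono mult_nonneg_nonneg) (use B k in \<open>auto simp: e_def\<close>)
  qed
  also have "\<dots> = (A + 4 * B / \<nu>\<^sup>2) * (e * exp (- m * t)) / k ^ 7"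
    using k \<nu>2 by (simp add: field_simps power_numeral_reduce)
  finally show ?thesis by (simp only: split[symmetric] k_def)
qed

section \<open>The fixed point problem on a single path\<close>

type_synonym bfield = "(real \<times> idx) \<Rightarrow>\<^sub>C (complex \<times> complex)"

text \<open>All probability is condensed into \<open>path\<close>. The constant in
  \<open>large\<close> comes from the contraction: on the ball of radius 2 R0 the Lipschitz constant
  is 20480 \<open>knorm_sum\<close> (2 R0) / \<nu>^2, and requiring at most 1/2 gives 81920.
  Invariance of the ball needs only half as much.\<close>

locale subcritical_path =
  fixes s \<eta> r \<nu> R0 :: real and Wp :: "real \<Rightarrow> real" and V0 :: fld
  assumes s: "1/2 \<le> s" "s \<le> 1" and pos: "0 < \<eta>" "0 < \<nu>" "0 < R0"
    and cont: "continuous_on {0..} Wp" and Wp0: "Wp 0 = 0"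
    and path: "\<And>t. 0 \<le> t \<Longrightarrow> \<nu> * Wp t \<le> r + \<nu>\<^sup>2 / 4 * t"
    and init: "symmetric V0" "div_free V0" "decays s (\<eta> + r) R0 V0"
    and large: "81920 * knorm_sum * R0 \<le> \<nu>\<^sup>2"
begin

definition rad :: "real \<Rightarrow> real" where "rad t = (\<eta> + r) + \<nu>\<^sup>2 / 4 * t"

definition noise :: "real \<Rightarrow> real" where "noise t = \<nu> * Wp t"

definition rate :: "idx \<Rightarrow> real" where "rate n = \<nu>\<^sup>2 / 2 * knorm n powr (2 * s)"

text \<open>The unknown of the fixed point problem is the rescaled coefficient \<open>g\<close>, bounded and continuous;
the field vanishes at \<open>n = 0\<close> because of the division by zero.\<close>

definition vfield :: "bfield \<Rightarrow> real \<Rightarrow> fld" where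
  "vfield g t n = (exp (- (rad t - noise t) * knorm n powr s) / knorm n ^ 7) *\<^sub>R apply_bcontfun g (t, n)"

definition nl :: "bfield \<Rightarrow> real \<Rightarrow> fld" where
  "nl g t = nonlin s (noise t) (vfield g t)"

definition mild :: "bfield \<Rightarrow> real \<Rightarrow> fld" where
  "mild g t n = exp (- rate n * t) *\<^sub>R (V0 n - integral {0..t} (\<lambda>\<tau>. exp (rate n * \<tau>) *\<^sub>R nl g \<tau> n))"

text \<open>\<open>mild g\<close> is U, hence the weight of radius \<open>rad\<close>;
  \<open>vfield\<close> undoes a weight of radius \<open>rad\<close> minus \<open>noise\<close> and
  so includes \<Gamma>^-1. A fixed point thus says that \<Gamma> V equals \<open>mild g\<close> at
  nonzero modes and times t \<ge> 0. The maximum with 0 continues the function constantly to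
  negative times.\<close>

definition picard_fun :: "bfield \<Rightarrow> real \<times> idx \<Rightarrow> complex \<times> complex" where
  "picard_fun g = (\<lambda>(t, n). (knorm n ^ 7 * exp (rad (max 0 t) * knorm n powr s)) *\<^sub>R mild g (max 0 t) n)"

definition picard :: "bfield \<Rightarrow> bfield" where
  "picard g = Bcontfun (picard_fun g)"

lemma s0: "0 < s" "s \<le> 1"
  using s by auto

lemma rad_noise: "0 \<le> t \<Longrightarrow> \<eta> \<le> rad t - noise t"
  using path[of t] by (simp add: rad_def noise_def)

lemma noise_le_rad: "0 \<le> t \<Longrightarrow> noise t \<le> rad t"
  using rad_noise[of t] pos by linarith

lemma vfield_decays: "decays s (rad t - noise t) (norm g) (vfield g t)"
  unfolding decays_def vfield_def
  using norm_bounded[of g] by (auto simp: mult.commute intro!: divide_right_mono mult_right_mono)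

lemma vfield_diff: "vfield (g - h) t = (\<lambda>n. vfield g t n - vfield h t n)"
  by (simp add: vfield_def scaleR_diff_right fun_eq_iff)

lemma continuous_on_noise: "continuous_on {0..} noise"
  unfolding noise_def by (intro continuous_intros cont)

lemma continuous_on_vfield: "continuous_on {0..} (\<lambda>t. vfield g t n)"
proof -
  have "continuous_on {0..} (\<lambda>t. apply_bcontfun g (t, n))"
    by (rule continuous_on_compose2[OF continuous_on_apply_bcontfun[of UNIV g]]) (auto intro!: continuous_intros)
  moreover have "continuous_on {0..} (\<lambda>t. exp (- (rad t - noise t) * knorm n powr s))"
    unfolding rad_def by (intro continuous_intros continuous_on_noise)
  ultimately show ?thesis
    unfolding vfield_def divide_inverse
    by (intro continuous_on_scaleR continuous_on_mult continuous_on_const)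
qed

lemma continuous_on_nl: "continuous_on {0..} (\<lambda>t. nl g t n)"
  unfolding nl_def
proof (rule continuous_on_nonlin[OF s0 _ _ continuous_on_vfield continuous_on_noise])
  show "0 \<le> \<eta>" using pos by simp
  show "decays s \<eta> (norm g) (vfield g t)" if "t \<in> {0..}" for t
    using that by (intro decays_mono[OF vfield_decays] rad_noise) simp
qed

lemma mild_zero: "mild g 0 n = V0 n"
  by (simp add: mild_def)

lemma mild_derivative:
  assumes t: "0 \<le> t"
  shows "((\<lambda>t. mild g t n) has_vector_derivative (- nl g t n - rate n *\<^sub>R mild g t n)) (at t within {0..})"
proof -
  let ?f = "\<lambda>\<tau>. exp (rate n * \<tau>) *\<^sub>R nl g \<tau> n"
  have "continuous_on {0..} ?f"
    by (intro continuous_intros continuous_on_nl)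
  hence "continuous_on {0..t + 1} ?f" by (rule continuous_on_subset) auto
  hence "((\<lambda>u. integral {0..u} ?f) has_vector_derivative ?f t) (at t within {0..t + 1})"
    by (rule integral_has_vector_derivative) (use t in auto)
  moreover have "at t within {0..t + 1} = at t within {0..}"
    by (rule at_within_nhd[of t "{..<t + 1}"]) auto
  ultimately have I: "((\<lambda>u. integral {0..u} ?f) has_vector_derivative ?f t) (at t within {0..})" by simp
  have "((\<lambda>t. exp (- rate n * t)) has_real_derivative (- rate n * exp (- rate n * t))) (at t within {0..})"
    by (auto intro!: derivative_eq_intros)
  from has_vector_derivative_scaleR[OF this has_vector_derivative_diff[OF has_vector_derivative_const I], of "V0 n"]
  have "((\<lambda>t. mild g t n) has_vector_derivative
     (exp (- rate n * t) *\<^sub>R (0 - ?f t) + (- rate n * exp (- rate n * t)) *\<^sub>R (V0 n - integral {0..t} ?f))) (at t within {0..})"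
    unfolding mild_def .
  moreover have "exp (- rate n * t) *\<^sub>R (0 - ?f t) = - nl g t n"
    by (simp add: exp_minus)
  ultimately show ?thesis by (simp add: mild_def)
qed

lemma continuous_on_mild: "continuous_on {0..} (\<lambda>t. mild g t n)"
  unfolding continuous_on_eq_continuous_within
  using has_vector_derivative_continuous[OF mild_derivative] by simp

lemma norm_mild_le:
  assumes "n \<noteq> 0" "0 \<le> t"
  shows "norm (mild g t n) \<le> (R0 + 10240 * knorm_sum * (norm g)\<^sup>2 / \<nu>\<^sup>2) * exp (- rad t * knorm n powr s) / knorm n ^ 7"
proof -
  have "norm (mild g t n) \<le> (R0 + 4 * (2560 * knorm_sum * norm g * norm g) / \<nu>\<^sup>2)
      * exp (- ((\<eta> + r) + \<nu>\<^sup>2 / 4 * t) * knorm n powr s) / knorm n ^ 7"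
  proof (rule duhamel_decay[OF assms s(1) pos(2)])
    show "((\<lambda>t. mild g t n) has_vector_derivative
        (- nl g \<tau> n - (\<nu>\<^sup>2 / 2 * knorm n powr (2 * s)) *\<^sub>R mild g \<tau> n)) (at \<tau> within {0..})" if "\<tau> \<in> {0..t}" for \<tau>
      using mild_derivative[of \<tau> g n] that by (simp add: rate_def)
    show "norm (mild g 0 n) \<le> R0 * exp (- (\<eta> + r) * knorm n powr s) / knorm n ^ 7"
      unfolding mild_zero by (rule decaysD) (rule init)
    show "norm (nl g \<tau> n) \<le> 2560 * knorm_sum * norm g * norm g * exp (- (\<eta> + r + \<nu>\<^sup>2 / 4 * \<tau>) * knorm n powr s) / knorm n ^ 6"
      if "\<tau> \<in> {0..t}" for \<tau>
      unfolding nl_def rad_def[symmetric]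
      by (rule norm_nonlin_le[OF s0 noise_le_rad vfield_decays assms(1)]) (use that in auto)
  qed
  thus ?thesis by (simp add: rad_def power2_eq_square mult.assoc)
qed

lemma norm_mild_diff_le:
  assumes "n \<noteq> 0" "0 \<le> t" "norm g \<le> R" "norm h \<le> R"
  shows "norm (mild g t n - mild h t n)
    \<le> (20480 * knorm_sum * R * norm (g - h) / \<nu>\<^sup>2) * exp (- rad t * knorm n powr s) / knorm n ^ 7"
proof -

  have "norm (mild g t n - mild h t n) \<le> (0 + 4 * (5120 * knorm_sum * R * norm (g - h)) / \<nu>\<^sup>2)
      * exp (- ((\<eta> + r) + \<nu>\<^sup>2 / 4 * t) * knorm n powr s) / knorm n ^ 7"
  proof (rule duhamel_decay[OF assms(1,2) s(1) pos(2)])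
    show "((\<lambda>t. mild g t n - mild h t n) has_vector_derivative
        (- (nl g \<tau> n - nl h \<tau> n) - (\<nu>\<^sup>2 / 2 * knorm n powr (2 * s)) *\<^sub>R (mild g \<tau> n - mild h \<tau> n))) (at \<tau> within {0..})"
      if "\<tau> \<in> {0..t}" for \<tau>
      using has_vector_derivative_diff[OF mild_derivative[of \<tau> g n] mild_derivative[of \<tau> h n]] that
      by (simp add: rate_def algebra_simps)
    show "norm (nl g \<tau> n - nl h \<tau> n)
        \<le> 5120 * knorm_sum * R * norm (g - h) * exp (- (\<eta> + r + \<nu>\<^sup>2 / 4 * \<tau>) * knorm n powr s) / knorm n ^ 6"
      if "\<tau> \<in> {0..t}" for \<tau>
      unfolding nl_def rad_def[symmetric]
    proof (rule norm_nonlin_diff_le[OF s0 noise_le_rad _ _ _ assms(1)])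
      show "decays s (rad \<tau> - noise \<tau>) (norm (g - h)) (\<lambda>n. vfield g \<tau> n - vfield h \<tau> n)"
        using vfield_decays[of \<tau> "g - h"] by (simp add: vfield_diff)
    qed (use that assms in \<open>auto intro: decays_radius_mono[OF vfield_decays]\<close>)
  qed (simp add: mild_zero)
  thus ?thesis by (simp add: rad_def mult.assoc)
qed

lemma weight_le:
  fixes a :: "complex \<times> complex"
  assumes "n \<noteq> 0 \<Longrightarrow> norm a \<le> X * exp (- \<phi> * knorm n powr s) / knorm n ^ 7" "0 \<le> X"
  shows "norm ((knorm n ^ 7 * exp (\<phi> * knorm n powr s)) *\<^sub>R a) \<le> X"
proof (cases "n = 0")
  case False
  have "knorm n ^ 7 * exp (\<phi> * knorm n powr s) * norm a
      \<le> knorm n ^ 7 * exp (\<phi> * knorm n powr s) * (X * exp (- \<phi> * knorm n powr s) / knorm n ^ 7)"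
    by (intro mult_left_mono assms False) auto
  also have "\<dots> = X" using False by (simp add: exp_minus)
  finally show ?thesis by simp
qed (use assms in simp)

lemma norm_picard_fun_le: "norm (picard_fun g (t, n)) \<le> R0 + 10240 * knorm_sum * (norm g)\<^sup>2 / \<nu>\<^sup>2"
  unfolding picard_fun_def prod.case
  by (rule weight_le) (use norm_mild_le pos knorm_sum_nonneg in auto)

text \<open>The index set is discrete, so the lines with fixed \<open>n\<close> are open and cover
  the domain; joint continuity reduces to continuity in time of each mode. The bound is uniform over
  modes because \<open>mild\<close> is estimated with the full weight.\<close>

lemma picard_fun_bcontfun: "picard_fun g \<in> bcontfun"
proof (rule bcontfun_normI)
  show "norm (picard_fun g x) \<le> R0 + 10240 * knorm_sum * (norm g)\<^sup>2 / \<nu>\<^sup>2" for x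
    using norm_picard_fun_le by (cases x) blast
  have "continuous_on (UNIV \<times> {n}) (picard_fun g)" for n
  proof -
    have "continuous_on UNIV (\<lambda>t. mild g (max 0 t) n)"
      by (rule continuous_on_compose2[OF continuous_on_mild]) (auto intro!: continuous_intros)
    hence "continuous_on UNIV (\<lambda>t. picard_fun g (t, n))"
      unfolding picard_fun_def prod.case rad_def by (intro continuous_intros)
    hence "continuous_on (UNIV \<times> {n}) (\<lambda>x. picard_fun g (fst x, n))"
      by (rule continuous_on_compose2) (auto intro!: continuous_intros)
    thus ?thesis by (rule continuous_on_cong[THEN iffD1, rotated 2]) auto
  qed
  moreover have "open (UNIV \<times> {n} :: (real \<times> idx) set)" for n
  proof -
    have "{n} = {fst n} \<times> {fst (snd n)} \<times> {snd (snd n)}" by (cases n) auto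
    moreover have "open ({fst n} \<times> {fst (snd n)} \<times> {snd (snd n)})"
      by (intro open_Times discrete_topology_class.open_discrete)
    ultimately show ?thesis by (intro open_Times) auto
  qed
  ultimately have "continuous_on (\<Union>n. UNIV \<times> {n}) (picard_fun g)"
    by (intro continuous_on_open_UN) auto
  moreover have "(\<Union>n. UNIV \<times> {n}) = (UNIV :: (real \<times> idx) set)" by auto
  ultimately show "continuous_on UNIV (picard_fun g)" by simp
qed

lemma picard_apply: "apply_bcontfun (picard g) x = picard_fun g x"
  by (simp add: picard_def Bcontfun_inverse[OF picard_fun_bcontfun])

lemma norm_picard_le:
  assumes "norm g \<le> 2 * R0" shows "norm (picard g) \<le> 2 * R0"
proof (rule norm_bound)
  fix x :: "real \<times> idx"
  have "norm (apply_bcontfun (picard g) x) \<le> R0 + 10240 * knorm_sum * (norm g)\<^sup>2 / \<nu>\<^sup>2"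
    using norm_picard_fun_le by (cases x) (simp add: picard_apply)
  also have "10240 * knorm_sum * (norm g)\<^sup>2 \<le> 10240 * knorm_sum * (2 * R0)\<^sup>2"
    using assms knorm_sum_nonneg by (intro mult_left_mono power_mono) auto
  also have "\<dots> \<le> (81920 * knorm_sum * R0) * R0"
    using knorm_sum_nonneg pos by (simp add: power2_eq_square mult_right_mono)
  also have "\<dots> \<le> \<nu>\<^sup>2 * R0" using large pos by (intro mult_right_mono) auto
  also have "\<nu>\<^sup>2 * R0 / \<nu>\<^sup>2 = R0" using pos by simp
  finally show "norm (apply_bcontfun (picard g) x) \<le> 2 * R0" by (simp add: divide_right_mono)
qed

lemma dist_picard_le:
  assumes "norm g \<le> 2 * R0" "norm h \<le> 2 * R0"
  shows "dist (picard g) (picard h) \<le> 1 / 2 * dist g h"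
  unfolding dist_norm
proof (rule norm_bound)
  fix x :: "real \<times> idx"
  obtain t n where x: "x = (t, n)" by (cases x)
  have "norm (picard_fun g (t, n) - picard_fun h (t, n))
      = norm ((knorm n ^ 7 * exp (rad (max 0 t) * knorm n powr s)) *\<^sub>R (mild g (max 0 t) n - mild h (max 0 t) n))"
    by (simp add: picard_fun_def scaleR_diff_right)
  also have "\<dots> \<le> 20480 * knorm_sum * (2 * R0) * norm (g - h) / \<nu>\<^sup>2"
    by (rule weight_le) (use norm_mild_diff_le[OF _ _ assms] pos knorm_sum_nonneg in auto)
  also have "\<dots> \<le> (\<nu>\<^sup>2 / 2) * norm (g - h) / \<nu>\<^sup>2"
    using large by (intro divide_right_mono mult_right_mono) auto
  also have "\<dots> = 1 / 2 * norm (g - h)" using pos by simp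
  finally show "norm (apply_bcontfun (picard g - picard h) x) \<le> 1 / 2 * norm (g - h)"
    by (simp add: x picard_apply)
qed

lemma vfield_symmetric:
  assumes "\<And>t. symmetric (\<lambda>n. apply_bcontfun g (t, n))"
  shows "symmetric (vfield g t)"
  unfolding symmetric_def
proof (intro conjI allI)
  fix n
  have g: "apply_bcontfun g (t, - n) = (cnj (fst (apply_bcontfun g (t, n))), cnj (snd (apply_bcontfun g (t, n))))" "apply_bcontfun g (t, mirror n) = apply_bcontfun g (t, n)"
    using assms[of t] unfolding symmetric_def by blast+
  show "vfield g t (- n) = (cnj (fst (vfield g t n)), cnj (snd (vfield g t n)))"
    by (simp add: vfield_def g scaleR_conv_of_real)
  show "vfield g t (mirror n) = vfield g t n" by (simp add: vfield_def g)
qed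

lemma rate_reflect [simp]: "rate (- n) = rate n" "rate (mirror n) = rate n"
  by (simp_all add: rate_def)

lemma integrable_nl: "0 \<le> t \<Longrightarrow> (\<lambda>\<tau>. exp (rate n * \<tau>) *\<^sub>R nl g \<tau> n) integrable_on {0..t}"
  by (rule integrable_continuous_interval, rule continuous_on_subset[of "{0..}"])
     (auto intro!: continuous_intros continuous_on_nl)

lemma mild_symmetric:
  assumes g: "\<And>t. symmetric (\<lambda>n. apply_bcontfun g (t, n))" and t: "0 \<le> t"
  shows "symmetric (mild g t)"
  unfolding symmetric_def
proof (intro conjI allI)
  fix n
  define h :: "complex \<times> complex \<Rightarrow> complex \<times> complex" where "h a = (cnj (fst a), cnj (snd a))" for a
  have h: "bounded_linear h" unfolding h_def
    by (intro bounded_linear_Pair bounded_linear_compose[OF bounded_linear_cnj] bounded_linear_fst bounded_linear_snd)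
  have nl: "nl g \<tau> (- n) = h (nl g \<tau> n)" "nl g \<tau> (mirror n) = nl g \<tau> n" for \<tau>
    using nonlin_symmetric[OF vfield_symmetric[OF g]] unfolding nl_def symmetric_def h_def by blast+
  have v: "V0 (- n) = h (V0 n)" "V0 (mirror n) = V0 n"
    using init(1) unfolding symmetric_def h_def by blast+
  have "h (mild g t n) = exp (- rate n * t) *\<^sub>R (h (V0 n) - h (integral {0..t} (\<lambda>\<tau>. exp (rate n * \<tau>) *\<^sub>R nl g \<tau> n)))"
    by (simp only: mild_def linear_diff[OF bounded_linear.linear[OF h]] linear_scale[OF bounded_linear.linear[OF h]])
  also have "h (integral {0..t} (\<lambda>\<tau>. exp (rate n * \<tau>) *\<^sub>R nl g \<tau> n))
      = integral {0..t} (\<lambda>\<tau>. h (exp (rate n * \<tau>) *\<^sub>R nl g \<tau> n))"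
    using integral_linear[OF integrable_nl[OF t] h, of n g] by (simp add: o_def)
  finally have "mild g t (- n) = h (mild g t n)"
    by (simp add: mild_def nl v linear_scale[OF bounded_linear.linear[OF h]])
  thus "mild g t (- n) = (cnj (fst (mild g t n)), cnj (snd (mild g t n)))" by (simp only: h_def)
  show "mild g t (mirror n) = mild g t n" by (simp add: mild_def nl v)
qed

lemma picard_symmetric:
  assumes "\<And>t. symmetric (\<lambda>n. apply_bcontfun g (t, n))"
  shows "symmetric (\<lambda>n. apply_bcontfun (picard g) (t, n))"
  unfolding symmetric_def
proof (intro conjI allI)
  fix n
  have m: "mild g (max 0 t) (- n) = (cnj (fst (mild g (max 0 t) n)), cnj (snd (mild g (max 0 t) n)))"
    "mild g (max 0 t) (mirror n) = mild g (max 0 t) n"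
    using mild_symmetric[OF assms max.cobounded1, of t] unfolding symmetric_def by blast+
  show "apply_bcontfun (picard g) (t, - n) = (cnj (fst (apply_bcontfun (picard g) (t, n))), cnj (snd (apply_bcontfun (picard g) (t, n))))"
    by (simp add: picard_apply picard_fun_def m scaleR_conv_of_real)
  show "apply_bcontfun (picard g) (t, mirror n) = apply_bcontfun (picard g) (t, n)" by (simp add: picard_apply picard_fun_def m)
qed

text \<open>At a barotropic mode the divergence is a bounded linear functional that kills V0 and,
  thanks to the projection, every value of the integrand. The fixed point inherits the constraint
  from Duhamel's formula, not from the set in which it is sought.\<close>

lemma mild_div_free:
  assumes t: "0 \<le> t" shows "div_free (mild g t)"
  unfolding div_free_def
proof (intro allI impI)
  fix n assume n: "k3 n = 0"
  define h :: "complex \<times> complex \<Rightarrow> complex" where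
    "h a = complex_of_real (k1 n) * fst a + complex_of_real (k2 n) * snd a" for a
  have h: "bounded_linear h" unfolding h_def
    by (intro bounded_linear_add bounded_linear_compose[OF bounded_linear_mult_right] bounded_linear_fst bounded_linear_snd)
  have hdot: "hdot f n = h (f n)" for f by (simp add: hdot_def h_def)
  have "hdot (nl g \<tau>) n = 0" for \<tau>
    using nonlin_div_free[of s "noise \<tau>" "vfield g \<tau>"] n unfolding div_free_def nl_def by blast
  hence nl: "h (nl g \<tau> n) = 0" for \<tau> by (simp only: hdot)
  have "hdot V0 n = 0" using init(2) n unfolding div_free_def by blast
  hence v: "h (V0 n) = 0" by (simp only: hdot)
  have "h (integral {0..t} (\<lambda>\<tau>. exp (rate n * \<tau>) *\<^sub>R nl g \<tau> n))
      = integral {0..t} (\<lambda>\<tau>. h (exp (rate n * \<tau>) *\<^sub>R nl g \<tau> n))"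
    using integral_linear[OF integrable_nl[OF t] h, of n g] by (simp add: o_def)
  also have "\<dots> = 0" by (simp add: linear_scale[OF bounded_linear.linear[OF h]] nl)
  finally show "hdot (mild g t) n = 0"
    unfolding hdot mild_def
    by (simp add: linear_scale[OF bounded_linear.linear[OF h]] linear_diff[OF bounded_linear.linear[OF h]] v)
qed

text \<open>A Cauchy sequence in the supremum distance converges uniformly, so its limit is bounded
  and continuous, and closedness puts it into \<open>S\<close>. This is the completeness that
  Banach's theorem asks for.\<close>

lemma complete_bcontfun_closed:
  fixes S :: "('x::topological_space \<Rightarrow>\<^sub>C 'y::complete_space) set"
  assumes "closed S" shows "Topological_Spaces.complete S"
proof (rule completeI)
  fix f assume f: "\<forall>i. f i \<in> S" and Cauchy: "Cauchy f"
  have "uniformly_Cauchy_on UNIV (\<lambda>i. apply_bcontfun (f i))"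
    unfolding uniformly_Cauchy_on_def
  proof (intro allI impI)
    fix e :: real assume "0 < e"
    then obtain N where "\<And>i j. N \<le> i \<Longrightarrow> N \<le> j \<Longrightarrow> dist (f i) (f j) < e"
      using metric_CauchyD[OF Cauchy] by blast
    thus "\<exists>N. \<forall>x\<in>UNIV. \<forall>i\<ge>N. \<forall>j\<ge>N. dist (apply_bcontfun (f i) x) (apply_bcontfun (f j) x) < e"
      using dist_fun_lt_imp_dist_val_lt by (intro exI[of _ N]) blast
  qed
  then obtain h where "uniform_limit UNIV (\<lambda>i. apply_bcontfun (f i)) h sequentially"
    using Cauchy_uniformly_convergent unfolding uniformly_convergent_on_def by blast
  from uniform_limit_bcontfunE[OF this sequentially_bot]
  obtain l where l: "f \<longlonglongrightarrow> l" by blast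
  have "l \<in> S" by (rule closed_sequentially[OF assms _ l]) (rule f[THEN spec])
  with l show "\<exists>l\<in>S. f \<longlonglongrightarrow> l" ..
qed

text \<open>Evaluation at a point is continuous for the supremum distance, so the symmetry equations
  cut out a closed part of the ball of radius 2 R0. Symmetry is built into the set because Q is
  identified with \<open>conv\<close> only on symmetric fields.\<close>

lemma picard_fixed_point:
  obtains g where "norm g \<le> 2 * R0" "\<And>t. symmetric (\<lambda>n. apply_bcontfun g (t, n))" "picard g = g"
proof -
  define S where "S = {g :: bfield. norm g \<le> 2 * R0 \<and> (\<forall>t. symmetric (\<lambda>n. apply_bcontfun g (t, n)))}"
  have ev: "continuous_on UNIV (\<lambda>g :: bfield. apply_bcontfun g x)" for x
    unfolding continuous_on_iff using dist_fun_lt_imp_dist_val_lt by blast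
  have S_eq: "S = {g. norm g \<le> 2 * R0}
      \<inter> (\<Inter>t n. {g. apply_bcontfun g (t, - n) = (cnj (fst (apply_bcontfun g (t, n))), cnj (snd (apply_bcontfun g (t, n))))})
      \<inter> (\<Inter>t n. {g. apply_bcontfun g (t, mirror n) = apply_bcontfun g (t, n)})"
    unfolding S_def symmetric_def by blast
  have "closed S"
    unfolding S_eq
    by (intro closed_Int closed_INT ballI closed_Collect_le closed_Collect_eq
        continuous_on_Pair continuous_on_cnj continuous_on_fst continuous_on_snd ev continuous_on_norm_id continuous_on_const)
  have "0 \<in> S" using pos by (simp add: S_def symmetric_def zero_prod_def)
  hence "S \<noteq> {}" by blast
  moreover have "picard ` S \<subseteq> S" using norm_picard_le picard_symmetric unfolding S_def by blast
  moreover have "dist (picard g) (picard h) \<le> 1 / 2 * dist g h" if "g \<in> S" "h \<in> S" for g h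
    using that by (intro dist_picard_le) (simp_all add: S_def)
  ultimately have "\<exists>!g\<in>S. picard g = g"
    by (intro Banach_fix[OF complete_bcontfun_closed[OF \<open>closed S\<close>], of "1 / 2"]) simp_all
  then obtain g where "g \<in> S" "picard g = g" by blast
  thus ?thesis using that unfolding S_def by blast
qed

lemma global_solution_exists:
  assumes \<sigma>: "0 \<le> \<sigma> * s" "\<sigma> * s \<le> 2"
  shows "\<exists>V. is_global_solution \<sigma> s \<eta> \<nu> Wp V0 V"
proof -
  obtain g where g: "norm g \<le> 2 * R0" "\<And>t. symmetric (\<lambda>n. apply_bcontfun g (t, n))" "picard g = g"
    using picard_fixed_point by blast
  define V where "V = vfield g"
  have V0_zero: "V0 0 = 0" by (rule decays_zero[OF init(3)])
  have V_mild: "V t n = exp (noise t * knorm n powr s) *\<^sub>R mild g t n" if "0 \<le> t" "n \<noteq> 0" for t n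
  proof -
    have "apply_bcontfun g (t, n) = (knorm n ^ 7 * exp (rad t * knorm n powr s)) *\<^sub>R mild g t n"
      using picard_apply[of g "(t, n)"] that by (simp add: g(3) picard_fun_def)
    moreover have "exp (- (rad t - noise t) * knorm n powr s) * exp (rad t * knorm n powr s) = exp (noise t * knorm n powr s)"
      by (simp add: exp_add[symmetric] algebra_simps)
    ultimately show ?thesis using that(2) unfolding V_def vfield_def by (simp add: field_simps)
  qed
  have V_zero: "V t 0 = 0" for t by (simp add: V_def vfield_def)
  have V_sym: "symmetric (V t)" for t unfolding V_def by (rule vfield_symmetric) (rule g)
  have V_decays: "decays s \<eta> (norm g) (V t)" if "0 \<le> t" for t
    unfolding V_def by (intro decays_mono[OF vfield_decays] rad_noise that)
  have V_div_free: "div_free (V t)" if t: "0 \<le> t" for t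
    unfolding div_free_def
  proof (intro allI impI)
    fix n assume n: "k3 n = 0"
    have "hdot (mild g t) n = 0" using mild_div_free[OF t] n unfolding div_free_def by blast
    thus "hdot (V t) n = 0"
      using V_mild[OF t, of n] V_zero
      by (cases "n = 0") (auto simp: hdot_def scaleR_conv_of_real mult.left_commute[of _ "complex_of_real (exp _)"] distrib_left[symmetric])
  qed
  have Gam_V: "Gam s (\<nu> * Wp t) (V t) n = (if n = 0 then 0 else mild g t n)" if "0 \<le> t" for t n
  proof -
    have "exp (- noise t * knorm n powr s) * exp (noise t * knorm n powr s) = 1"
      by (simp add: exp_add[symmetric])
    thus ?thesis using V_mild[OF that, of n] V_zero by (simp add: Gam_eq noise_def)
  qed
  have "is_global_solution \<sigma> s \<eta> \<nu> Wp V0 V"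
    unfolding is_global_solution_def Let_def admissible_iff_symmetric
  proof (intro conjI allI impI)
    show "V 0 = V0"
    proof
      fix n show "V 0 n = V0 n"
        using V_mild[of 0 n] V_zero V0_zero by (cases "n = 0") (simp_all add: mild_zero noise_def Wp0)
    qed
  next
    fix t :: real assume t: "0 \<le> t"
    show "in_H (V t)"
      unfolding in_H_iff using decays_summable[OF V_decays[OF t]] pos V_zero V_div_free[OF t] by simp
    show "symmetric (V t)" by (rule V_sym)
    show "in_gevrey \<sigma> s \<eta> (V t)" using decays_in_gevrey[OF V_decays[OF t] _ \<sigma>] pos by simp
  next
    fix t0 :: real assume t0: "0 \<le> t0"
    define d where "d t n = V t n - V t0 n" for t n
    have d_decays: "decays s \<eta> (2 * norm g) (d t)" if "0 \<le> t" for t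
      unfolding decays_def
    proof
      fix n
      show "norm (d t n) \<le> 2 * norm g * exp (- \<eta> * knorm n powr s) / knorm n ^ 7"
        using norm_triangle_ineq4[of "V t n" "V t0 n"] decaysD[OF V_decays[OF that], of n] decaysD[OF V_decays[OF t0], of n]
        by (simp add: d_def)
    qed
    \<comment> \<open>Each mode is continuous and the summands have a summable majorant of order
      |k|^-6 independent of time, so the squared Gevrey norm of the increment is continuous and its
      value at t0 is 0.\<close>
    have "continuous_on {0..} (\<lambda>t. \<Sum>\<^sub>\<infinity>n. gweight \<sigma> s \<eta> n * csq (d t n))"
    proof (rule continuous_on_infsum)
      show "continuous_on {0..} (\<lambda>t. gweight \<sigma> s \<eta> n * csq (d t n))" for n
        unfolding csq_eq_norm d_def V_def by (intro continuous_intros continuous_on_vfield)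
      show "norm (gweight \<sigma> s \<eta> n * csq (d t n)) \<le> 2 * (2 * norm g)\<^sup>2 * (1 / knorm n ^ 6)" if "t \<in> {0..}" for t n
        using gweight_decays_le[OF d_decays \<sigma>, of t n] that pos by (simp add: gweight_nonneg csq_eq_norm)
      show "(\<lambda>n. 2 * (2 * norm g)\<^sup>2 * (1 / knorm n ^ 6)) summable_on UNIV"
        by (intro summable_on_cmult_right summable_on_knorm_inverse)
    qed
    hence "continuous_on {0..} (\<lambda>t. gnorm \<sigma> s \<eta> (d t))"
      unfolding gnorm_def by (intro continuous_on_real_sqrt)
    hence "((\<lambda>t. gnorm \<sigma> s \<eta> (d t)) \<longlongrightarrow> gnorm \<sigma> s \<eta> (d t0)) (at t0 within {0..})"
      using t0 by (simp add: continuous_on_def)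
    moreover have "gnorm \<sigma> s \<eta> (d t0) = 0" by (simp add: gnorm_def d_def csq_def)
    moreover have "d = (\<lambda>t n. V t n - V t0 n)" by (intro ext) (simp only: d_def)
    ultimately show "((\<lambda>t. gnorm \<sigma> s \<eta> (\<lambda>n. V t n - V t0 n)) \<longlongrightarrow> 0) (at t0 within {0..})"
      by simp
  next
    fix t :: real and n assume t: "0 \<le> t"
    have "((\<lambda>\<tau>. if n = 0 then 0 else mild g \<tau> n) has_vector_derivative
       (- nl g t n - rate n *\<^sub>R (if n = 0 then 0 else mild g t n))) (at t within {0..})"
    proof (cases "n = 0")
      case True
      \<comment> \<open>\<open>vfield\<close> sets the mean to 0 whatever \<open>mild g t 0\<close>
        is, so at n = 0 the equation demands that the nonlinearity have mean zero; incompressibility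
        of V provides this.\<close>
      have "nl g t 0 = 0" using nonlin_zero_mode[OF V_div_free[OF t]] unfolding nl_def V_def .
      thus ?thesis using True by simp
    next
      case False
      thus ?thesis using mild_derivative[OF t] by simp
    qed
    hence "((\<lambda>\<tau>. if n = 0 then 0 else mild g \<tau> n) has_vector_derivative
       (- nl g t n - rate n *\<^sub>R Gam s (\<nu> * Wp t) (V t) n)) (at t within {0..})"
      by (simp only: Gam_V[OF t])
    hence "((\<lambda>\<tau>. Gam s (\<nu> * Wp \<tau>) (V \<tau>) n) has_vector_derivative
       (- nl g t n - rate n *\<^sub>R Gam s (\<nu> * Wp t) (V t) n)) (at t within {0..})"
      by (rule has_vector_derivative_transform[rotated 2]) (use t Gam_V in auto)
    thus "((\<lambda>\<tau>. Gam s (\<nu> * Wp \<tau>) (V \<tau>) n) has_vector_derivative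
       (- Pproj (Gam s (\<nu> * Wp t) (Qco (Gam s (- \<nu> * Wp t) (Gam s (\<nu> * Wp t) (V t)))
            (Gam s (- \<nu> * Wp t) (Gam s (\<nu> * Wp t) (V t))))) n
       - cscale (complex_of_real (\<nu>\<^sup>2 / 2 * knorm n powr (2 * s))) (Gam s (\<nu> * Wp t) (V t) n))) (at t within {0..})"
      unfolding mult_minus_left Gam_uminus_Gam Qco_symmetric[OF V_sym] cscale_of_real
      by (simp only: nl_def nonlin_def rate_def noise_def V_def)
  qed
  thus ?thesis by blast
qed

end

section \<open>Brownian motion below a line\<close>

text \<open>Completing the square: the exponential factor moves the mean of the Gaussian from 0 to
  \<theta> \<sigma>^2, and the integrand is again a probability density.\<close>

lemma nn_integral_exp_normal_density:
  fixes \<theta> \<sigma> :: real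
  assumes "0 < \<sigma>"
  shows "(\<integral>\<^sup>+x. ennreal (normal_density 0 \<sigma> x) * ennreal (exp (\<theta> * x - \<theta>\<^sup>2 * \<sigma>\<^sup>2 / 2)) \<partial>lborel) = 1"
proof -
  have "normal_density 0 \<sigma> x * exp (\<theta> * x - \<theta>\<^sup>2 * \<sigma>\<^sup>2 / 2) = normal_density (\<theta> * \<sigma>\<^sup>2) \<sigma> x" for x
  proof -
    have "- (x - 0)\<^sup>2 / (2 * \<sigma>\<^sup>2) + (\<theta> * x - \<theta>\<^sup>2 * \<sigma>\<^sup>2 / 2) = - (x - \<theta> * \<sigma>\<^sup>2)\<^sup>2 / (2 * \<sigma>\<^sup>2)"
      using assms by (simp add: field_simps power2_eq_square)
    thus ?thesis by (simp add: normal_density_def mult.assoc exp_add[symmetric])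
  qed
  hence "(\<integral>\<^sup>+x. ennreal (normal_density 0 \<sigma> x) * ennreal (exp (\<theta> * x - \<theta>\<^sup>2 * \<sigma>\<^sup>2 / 2)) \<partial>lborel)
      = (\<integral>\<^sup>+x. ennreal (normal_density (\<theta> * \<sigma>\<^sup>2) \<sigma> x) \<partial>lborel)"
    by (simp add: ennreal_mult[symmetric])
  also have "\<dots> = ennreal (\<integral>x. normal_density (\<theta> * \<sigma>\<^sup>2) \<sigma> x \<partial>lborel)"
    using assms by (intro nn_integral_eq_integral) auto
  finally show ?thesis using assms by simp
qed



section \<open>Stopped products of independent factors\<close>

definition below :: "real \<Rightarrow> (nat \<Rightarrow> real) \<Rightarrow> nat \<Rightarrow> bool" where
  "below K y j \<longleftrightarrow> (\<forall>i\<le>j. (\<Prod>l<i. y l) < K)"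

text \<open>The product stopped at the first index where a partial product reaches K; the empty
  product 1 counts among them. Whether \<open>y j\<close> is used is decided by the earlier factors
  alone, so for independent factors it is independent of that decision.\<close>

fun stopped_prod :: "real \<Rightarrow> (nat \<Rightarrow> real) \<Rightarrow> nat \<Rightarrow> real" where
  "stopped_prod K y 0 = 1"
| "stopped_prod K y (Suc j) =
     (if below K y j then stopped_prod K y j * y j else stopped_prod K y j)"

lemma stopped_prod_eq_prod: "\<forall>i<j. (\<Prod>l<i. y l) < K \<Longrightarrow> stopped_prod K y j = (\<Prod>l<j. y l)"
  by (induction j) (simp_all add: less_Suc_eq_le below_def)

text \<open>At the first index reaching K the stopped product still equals the plain one, and from
  then on it is frozen; the whole history up to j is thereby encoded in one value.\<close>

lemma stopped_prod_ge: "\<exists>i\<le>j. K \<le> (\<Prod>l<i. y l) \<Longrightarrow> K \<le> stopped_prod K y j"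
proof (induction j)
  case (Suc j)
  show ?case
  proof (cases "\<exists>i\<le>j. K \<le> (\<Prod>l<i. y l)")
    case True
    hence "\<not> below K y j" by (auto simp: below_def not_less)
    with Suc.IH[OF True] show ?thesis by simp
  next
    case False
    hence "\<forall>i<Suc j. (\<Prod>l<i. y l) < K" by (meson less_Suc_eq_le not_le)
    hence "stopped_prod K y (Suc j) = (\<Prod>l<Suc j. y l)" by (rule stopped_prod_eq_prod)
    moreover have "K \<le> (\<Prod>l<Suc j. y l)" using Suc.prems False le_Suc_eq by blast
    ultimately show ?thesis by simp
  qed
qed simp

lemma stopped_prod_nonneg: "\<forall>i<j. 0 \<le> y i \<Longrightarrow> 0 \<le> stopped_prod K y j"
  by (induction j) auto

lemma below_cong:
  assumes "\<forall>i<j. y i = y' i" shows "below K y j = below K y' j"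
proof -
  have "(\<Prod>l<i. y l) = (\<Prod>l<i. y' l)" if "i \<le> j" for i
    using assms that by (intro prod.cong) auto
  thus ?thesis by (simp add: below_def)
qed

lemma stopped_prod_cong: "\<forall>i<j. y i = y' i \<Longrightarrow> stopped_prod K y j = stopped_prod K y' j"
proof (induction j)
  case (Suc j)
  have "below K y j = below K y' j" using Suc.prems by (intro below_cong) simp
  thus ?case using Suc by simp
qed simp

lemma measurable_below:
  assumes "\<And>i. i < j \<Longrightarrow> Y i \<in> borel_measurable M"
  shows "Measurable.pred M (\<lambda>\<omega>. below K (\<lambda>i. Y i \<omega>) j)"
proof -
  have "Measurable.pred M (\<lambda>\<omega>. (\<Prod>l<i. Y l \<omega>) < K)" if "i \<le> j" for i
  proof -
    have [measurable]: "(\<lambda>\<omega>. \<Prod>l<i. Y l \<omega>) \<in> borel_measurable M"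
      using assms that by (intro borel_measurable_prod) auto
    show ?thesis by measurable
  qed
  hence "Measurable.pred M (\<lambda>\<omega>. \<forall>i\<in>{..j}. (\<Prod>l<i. Y l \<omega>) < K)"
    by (intro pred_intros_finite(3)) simp_all
  thus ?thesis unfolding below_def Ball_def atMost_iff .
qed

lemma measurable_stopped_prod:
  assumes "\<And>i. i < j \<Longrightarrow> (\<lambda>\<omega>. Y i \<omega>) \<in> borel_measurable M"
  shows "(\<lambda>\<omega>. stopped_prod K (\<lambda>i. Y i \<omega>) j) \<in> borel_measurable M"
  using assms
proof (induction j)
  case (Suc j)
  have [measurable]: "(\<lambda>\<omega>. stopped_prod K (\<lambda>i. Y i \<omega>) j) \<in> borel_measurable M" "Y j \<in> borel_measurable M"
    using Suc by auto
  have [measurable]: "Measurable.pred M (\<lambda>\<omega>. below K (\<lambda>i. Y i \<omega>) j)"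
    using Suc.prems by (intro measurable_below) auto
  show ?case by simp
qed simp

context prob_space
begin

text \<open>Each step of the stopped product multiplies by an independent factor of mean at most 1,
so its expectation stays at most 1; Markov's inequality then gives the maximal inequality.\<close>

lemma nn_integral_stopped_prod_le:
  assumes ind: "indep_vars (\<lambda>_. borel) Y {..<N}"
    and nonneg: "\<And>i \<omega>. i < N \<Longrightarrow> 0 \<le> Y i \<omega>"
    and le: "\<And>i. i < N \<Longrightarrow> (\<integral>\<^sup>+\<omega>. ennreal (Y i \<omega>) \<partial>M) \<le> 1"
  shows "j \<le> N \<Longrightarrow> (\<integral>\<^sup>+\<omega>. ennreal (stopped_prod K (\<lambda>i. Y i \<omega>) j) \<partial>M) \<le> 1"
proof (induction j)
  case 0
  show ?case by (simp add: emeasure_space_1)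
next
  case (Suc j)
  hence jN: "j < N" by simp
  have Ym: "Y i \<in> borel_measurable M" if "i < N" for i
    using ind that by (auto simp: indep_vars_def2)
  \<comment> \<open>\<open>F\<close> is the part still running and \<open>G\<close> the part already
    frozen. They add up to the stopped product at \<open>j\<close>, and only \<open>F\<close>
    receives the new factor.\<close>
  define F where "F y = (if below K y j then ennreal (stopped_prod K y j) else 0)" for y
  define G where "G y = (if below K y j then 0 else ennreal (stopped_prod K y j))" for y
  have Fm: "(\<lambda>\<omega>. F (\<lambda>i. X i \<omega>)) \<in> borel_measurable L" "(\<lambda>\<omega>. G (\<lambda>i. X i \<omega>)) \<in> borel_measurable L"
    if "\<And>i. i < j \<Longrightarrow> X i \<in> borel_measurable L" for X :: "nat \<Rightarrow> 'x \<Rightarrow> real" and L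
  proof -
    have [measurable]: "(\<lambda>\<omega>. stopped_prod K (\<lambda>i. X i \<omega>) j) \<in> borel_measurable L"
      using that by (rule measurable_stopped_prod)
    have [measurable]: "Measurable.pred L (\<lambda>\<omega>. below K (\<lambda>i. X i \<omega>) j)"
      using that by (rule measurable_below)
    show "(\<lambda>\<omega>. F (\<lambda>i. X i \<omega>)) \<in> borel_measurable L" "(\<lambda>\<omega>. G (\<lambda>i. X i \<omega>)) \<in> borel_measurable L"
      unfolding F_def G_def by measurable
  qed
  have FY: "(\<lambda>\<omega>. F (\<lambda>i. Y i \<omega>)) \<in> borel_measurable M" "(\<lambda>\<omega>. G (\<lambda>i. Y i \<omega>)) \<in> borel_measurable M"
    by (rule Fm; use Ym jN in auto)+
  \<comment> \<open>\<open>F\<close> sees only the coordinates below \<open>j\<close>, so it is a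
    function of a block of variables that is independent of the block consisting of
    \<open>j\<close>.\<close>
  have F_restrict: "F (restrict y {..<j}) = F y" for y
  proof -
    have "below K (restrict y {..<j}) j = below K y j"
      by (rule below_cong) auto
    moreover have "stopped_prod K (restrict y {..<j}) j = stopped_prod K y j"
      by (rule stopped_prod_cong) auto
    ultimately show ?thesis by (simp add: F_def)
  qed
  have "indep_var (PiM {..<j} (\<lambda>_. borel)) (\<lambda>\<omega>. restrict (\<lambda>i. Y i \<omega>) {..<j})
          (PiM {j} (\<lambda>_. borel)) (\<lambda>\<omega>. restrict (\<lambda>i. Y i \<omega>) {j})"
    by (rule indep_var_restrict[OF ind]) (use jN in auto)
  hence "indep_var borel (F \<circ> (\<lambda>\<omega>. restrict (\<lambda>i. Y i \<omega>) {..<j}))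
      borel ((\<lambda>y. ennreal (y j)) \<circ> (\<lambda>\<omega>. restrict (\<lambda>i. Y i \<omega>) {j}))"
  proof (rule indep_var_compose)
    show "F \<in> borel_measurable (PiM {..<j} (\<lambda>_. borel))"
      by (rule Fm(1)[of "\<lambda>i y. y i"]) simp
  qed simp
  hence "indep_var borel (\<lambda>\<omega>. F (\<lambda>i. Y i \<omega>)) borel (\<lambda>\<omega>. ennreal (Y j \<omega>))"
    by (simp add: o_def F_restrict)
  hence "indep_vars (\<lambda>_. borel) (case_bool (\<lambda>\<omega>. F (\<lambda>i. Y i \<omega>)) (\<lambda>\<omega>. ennreal (Y j \<omega>))) UNIV"
    unfolding indep_var_def by (subst indep_vars_cong[OF refl refl]) (auto split: bool.split)
  from indep_vars_nn_integral[OF _ this]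
  have prod: "(\<integral>\<^sup>+\<omega>. F (\<lambda>i. Y i \<omega>) * ennreal (Y j \<omega>) \<partial>M)
      = (\<integral>\<^sup>+\<omega>. F (\<lambda>i. Y i \<omega>) \<partial>M) * (\<integral>\<^sup>+\<omega>. ennreal (Y j \<omega>) \<partial>M)"
    by (simp add: UNIV_bool mult.commute)
  have "(\<integral>\<^sup>+\<omega>. ennreal (stopped_prod K (\<lambda>i. Y i \<omega>) (Suc j)) \<partial>M)
      = (\<integral>\<^sup>+\<omega>. F (\<lambda>i. Y i \<omega>) * ennreal (Y j \<omega>) + G (\<lambda>i. Y i \<omega>) \<partial>M)"
    using nonneg jN stopped_prod_nonneg[of j "\<lambda>i. Y i \<omega>" K for \<omega>]
    by (intro nn_integral_cong) (auto simp: F_def G_def ennreal_mult)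
  also have "\<dots> = (\<integral>\<^sup>+\<omega>. F (\<lambda>i. Y i \<omega>) \<partial>M) * (\<integral>\<^sup>+\<omega>. ennreal (Y j \<omega>) \<partial>M) + (\<integral>\<^sup>+\<omega>. G (\<lambda>i. Y i \<omega>) \<partial>M)"
    using FY Ym[OF jN] by (subst nn_integral_add) (auto simp: prod)
  also have "\<dots> \<le> (\<integral>\<^sup>+\<omega>. F (\<lambda>i. Y i \<omega>) \<partial>M) * 1 + (\<integral>\<^sup>+\<omega>. G (\<lambda>i. Y i \<omega>) \<partial>M)"
    by (intro add_mono mult_left_mono le jN) auto
  also have "\<dots> = (\<integral>\<^sup>+\<omega>. F (\<lambda>i. Y i \<omega>) + G (\<lambda>i. Y i \<omega>) \<partial>M)"
    using FY by (subst nn_integral_add) auto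
  also have "\<dots> = (\<integral>\<^sup>+\<omega>. ennreal (stopped_prod K (\<lambda>i. Y i \<omega>) j) \<partial>M)"
    by (intro nn_integral_cong) (auto simp: F_def G_def)
  also have "\<dots> \<le> 1" using Suc by simp
  finally show ?case .
qed

lemma maximal_inequality_prod:
  fixes Y :: "nat \<Rightarrow> 'a \<Rightarrow> real"
  assumes ind: "indep_vars (\<lambda>_. borel) Y {..<N}"
    and nonneg: "\<And>i \<omega>. i < N \<Longrightarrow> 0 \<le> Y i \<omega>"
    and le: "\<And>i. i < N \<Longrightarrow> (\<integral>\<^sup>+\<omega>. ennreal (Y i \<omega>) \<partial>M) \<le> 1"
    and K: "0 < K"
  shows "prob {\<omega>\<in>space M. \<exists>j\<le>N. K \<le> (\<Prod>i<j. Y i \<omega>)} \<le> 1 / K"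
proof -
  have Ym: "Y i \<in> borel_measurable M" if "i < N" for i
    using ind that by (auto simp: indep_vars_def2)
  have Sm: "(\<lambda>\<omega>. stopped_prod K (\<lambda>i. Y i \<omega>) N) \<in> borel_measurable M"
    by (rule measurable_stopped_prod) (rule Ym)
  have "emeasure M {\<omega>\<in>space M. \<exists>j\<le>N. K \<le> (\<Prod>i<j. Y i \<omega>)}
      \<le> emeasure M {\<omega>\<in>space M. 1 \<le> ennreal (1 / K) * ennreal (stopped_prod K (\<lambda>i. Y i \<omega>) N)}"
  proof (intro emeasure_mono subsetI)
    fix \<omega> assume "\<omega> \<in> {\<omega>\<in>space M. \<exists>j\<le>N. K \<le> (\<Prod>i<j. Y i \<omega>)}"
    hence "K \<le> stopped_prod K (\<lambda>i. Y i \<omega>) N" "\<omega> \<in> space M" using stopped_prod_ge by auto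
    thus "\<omega> \<in> {\<omega>\<in>space M. 1 \<le> ennreal (1 / K) * ennreal (stopped_prod K (\<lambda>i. Y i \<omega>) N)}"
      using K by (simp add: ennreal_mult[symmetric] field_simps)
  next
    show "{\<omega>\<in>space M. 1 \<le> ennreal (1 / K) * ennreal (stopped_prod K (\<lambda>i. Y i \<omega>) N)} \<in> sets M"
      using Sm by measurable
  qed
  also have "\<dots> \<le> ennreal (1 / K) * (\<integral>\<^sup>+\<omega>. ennreal (stopped_prod K (\<lambda>i. Y i \<omega>) N) * indicator (space M) \<omega> \<partial>M)"
    using Sm by (intro nn_integral_Markov_inequality) auto
  also have "\<dots> = ennreal (1 / K) * (\<integral>\<^sup>+\<omega>. ennreal (stopped_prod K (\<lambda>i. Y i \<omega>) N) \<partial>M)"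
    by (intro arg_cong2[where f = "(*)"] refl nn_integral_cong) simp
  also have "\<dots> \<le> ennreal (1 / K) * 1"
    by (intro mult_left_mono nn_integral_stopped_prod_le[OF ind nonneg le]) auto
  finally show ?thesis using K by (simp add: emeasure_eq_measure)
qed

end

text \<open>For \<theta> = 2b the exponential martingale exp(\<theta> W - \<theta>^2 t / 2) is
  exp(2b (W - b t)), whose level exp(2ab) is reached exactly on or above the line a + b t. At grid
  times it is a product of independent factors of mean 1.\<close>

lemma brownian_grid_bound:
  fixes a b :: real
  assumes BM: "brownian_motion M W" and ab: "0 < a" "0 < b" and h: "0 < h"
  shows "measure M {\<omega>\<in>space M. \<exists>j\<le>N. a + b * (real j * h) \<le> W (real j * h) \<omega>} \<le> exp (- 2 * a * b)"
proof -
  interpret prob_space M using BM by (simp add: brownian_motion_def)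
  have W0: "W 0 \<omega> = 0" if "\<omega> \<in> space M" for \<omega> using BM that by (simp add: brownian_motion_def)
  define ts where "ts i = real i * h" for i
  define X where "X i \<omega> = W (ts (Suc i)) \<omega> - W (ts i) \<omega>" for i \<omega>
  define Y where "Y i \<omega> = exp (2 * b * X i \<omega> - (2 * b)\<^sup>2 * (sqrt h)\<^sup>2 / 2)" for i \<omega>
  have "0 \<le> ts 0" "\<forall>i<N. ts i < ts (Suc i)" using h by (auto simp: ts_def)
  hence "indep_vars (\<lambda>_. borel) (\<lambda>i \<omega>. W (ts (Suc i)) \<omega> - W (ts i) \<omega>) {..<N}"
    using BM unfolding brownian_motion_def by blast
  hence indX: "indep_vars (\<lambda>_. borel) X {..<N}" unfolding X_def .
  have ind: "indep_vars (\<lambda>_. borel) Y {..<N}"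
    unfolding Y_def by (rule indep_vars_compose2[OF indX]) simp
  have le: "(\<integral>\<^sup>+\<omega>. ennreal (Y i \<omega>) \<partial>M) \<le> 1" for i
  proof -
    have "0 \<le> ts i" "ts i < ts (Suc i)" using h by (auto simp: ts_def)
    hence "distributed M lborel (\<lambda>\<omega>. W (ts (Suc i)) \<omega> - W (ts i) \<omega>)
        (\<lambda>x. ennreal (normal_density 0 (sqrt (ts (Suc i) - ts i)) x))"
      using BM unfolding brownian_motion_def by blast
    hence "distributed M lborel (X i) (\<lambda>x. ennreal (normal_density 0 (sqrt (ts (Suc i) - ts i)) x))"
      unfolding X_def .
    moreover have "ts (Suc i) - ts i = h" by (simp add: ts_def algebra_simps)
    ultimately have D: "distributed M lborel (X i) (\<lambda>x. ennreal (normal_density 0 (sqrt h) x))" by simp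
    have "(\<integral>\<^sup>+\<omega>. ennreal (Y i \<omega>) \<partial>M)
        = (\<integral>\<^sup>+x. ennreal (normal_density 0 (sqrt h) x) * ennreal (exp (2 * b * x - (2 * b)\<^sup>2 * (sqrt h)\<^sup>2 / 2)) \<partial>lborel)"
      unfolding Y_def by (rule distributed_nn_integral[OF D, symmetric]) simp
    also have "\<dots> = 1" using h by (intro nn_integral_exp_normal_density) simp
    finally show ?thesis by simp
  qed
  have prod: "(\<Prod>i<j. Y i \<omega>) = exp (2 * b * (W (real j * h) \<omega> - b * (real j * h)))" if "\<omega> \<in> space M" for j \<omega>
  proof -
    have "(\<Prod>i<j. Y i \<omega>) = exp (\<Sum>i<j. 2 * b * X i \<omega> - (2 * b)\<^sup>2 * (sqrt h)\<^sup>2 / 2)"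
      by (simp add: Y_def exp_sum)
    also have "(\<Sum>i<j. 2 * b * X i \<omega> - (2 * b)\<^sup>2 * (sqrt h)\<^sup>2 / 2)
        = 2 * b * (\<Sum>i<j. X i \<omega>) - real j * ((2 * b)\<^sup>2 * (sqrt h)\<^sup>2 / 2)"
      by (simp add: sum_subtractf sum_distrib_left)
    also have "(\<Sum>i<j. X i \<omega>) = W (real j * h) \<omega>"
      unfolding X_def by (subst sum_lessThan_telescope) (simp add: ts_def W0[OF that])
    finally show ?thesis using h by (simp add: power2_eq_square algebra_simps)
  qed
  have "{\<omega>\<in>space M. \<exists>j\<le>N. a + b * (real j * h) \<le> W (real j * h) \<omega>}
      = {\<omega>\<in>space M. \<exists>j\<le>N. exp (2 * a * b) \<le> (\<Prod>i<j. Y i \<omega>)}"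
  proof (intro Collect_cong conj_cong refl)
    fix \<omega> assume "\<omega> \<in> space M"
    have "2 * a * b \<le> 2 * b * (W (real j * h) \<omega> - b * (real j * h)) \<longleftrightarrow> a + b * (real j * h) \<le> W (real j * h) \<omega>" for j
    proof -
      have "2 * a * b \<le> 2 * b * (W (real j * h) \<omega> - b * (real j * h))
          \<longleftrightarrow> (2 * b) * a \<le> (2 * b) * (W (real j * h) \<omega> - b * (real j * h))" by (simp add: algebra_simps)
      also have "\<dots> \<longleftrightarrow> a \<le> W (real j * h) \<omega> - b * (real j * h)" using ab by (intro mult_le_cancel_left_pos) simp
      finally show ?thesis by linarith
    qed
    thus "(\<exists>j\<le>N. a + b * (real j * h) \<le> W (real j * h) \<omega>) \<longleftrightarrow> (\<exists>j\<le>N. exp (2 * a * b) \<le> (\<Prod>i<j. Y i \<omega>))"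
      by (simp only: prod[OF \<open>\<omega> \<in> space M\<close>] exp_le_cancel_iff)
  qed
  moreover have "prob {\<omega>\<in>space M. \<exists>j\<le>N. exp (2 * a * b) \<le> (\<Prod>i<j. Y i \<omega>)} \<le> 1 / exp (2 * a * b)"
    by (rule maximal_inequality_prod[OF ind _ le]) (auto simp: Y_def)
  ultimately show ?thesis by (simp add: exp_minus inverse_eq_divide)
qed

text \<open>The grid bound is uniform in mesh and horizon. The dyadic grids of mesh 2^-m on [0, m]
  are nested, so the bad events increase and the bound passes to their union; outside it, path
  continuity carries the inequality from dyadic times to all times.\<close>

lemma brownian_linear_bound:
  fixes a b :: real
  assumes BM: "brownian_motion M W" and ab: "0 < a" "0 < b"
  obtains A where "A \<in> sets M" "measure M A \<ge> 1 - exp (- 2 * a * b)"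
    "\<And>\<omega> t. \<omega> \<in> A \<Longrightarrow> 0 \<le> t \<Longrightarrow> W t \<omega> \<le> a + b * t"
proof -
  interpret prob_space M using BM by (simp add: brownian_motion_def)
  have [measurable]: "W t \<in> borel_measurable M" for t using BM by (simp add: brownian_motion_def)
  define B where "B m = {\<omega>\<in>space M. \<exists>j\<le>m * 2 ^ m. a + b * (real j * (1 / 2 ^ m)) \<le> W (real j * (1 / 2 ^ m)) \<omega>}" for m :: nat
  have Bm [measurable]: "B m \<in> sets M" for m
  proof -
    have "B m = (\<Union>j\<in>{..m * 2 ^ m}. {\<omega>\<in>space M. a + b * (real j * (1 / 2 ^ m)) \<le> W (real j * (1 / 2 ^ m)) \<omega>})"
      by (auto simp: B_def)
    also have "\<dots> \<in> sets M" by measurable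
    finally show ?thesis .
  qed
  have "incseq B"
  proof (rule incseq_SucI, rule subsetI)
    fix m \<omega> assume "\<omega> \<in> B m"
    then obtain j where j: "\<omega> \<in> space M" "j \<le> m * 2 ^ m" "a + b * (real j * (1 / 2 ^ m)) \<le> W (real j * (1 / 2 ^ m)) \<omega>"
      by (auto simp: B_def)
    have "real (2 * j) * (1 / 2 ^ Suc m) = real j * (1 / 2 ^ m)" by simp
    moreover have "2 * j \<le> Suc m * 2 ^ Suc m" using j(2) by simp
    ultimately show "\<omega> \<in> B (Suc m)" using j unfolding B_def by (metis (mono_tags, lifting) mem_Collect_eq)
  qed
  hence "(\<lambda>m. prob (B m)) \<longlonglongrightarrow> prob (\<Union>m. B m)"
    by (intro finite_Lim_measure_incseq) auto
  moreover have "prob (B m) \<le> exp (- 2 * a * b)" for m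
    unfolding B_def by (rule brownian_grid_bound[OF BM ab]) simp
  ultimately have le: "prob (\<Union>m. B m) \<le> exp (- 2 * a * b)"
    by (intro LIMSEQ_le_const2) auto
  show ?thesis
  proof
    show "space M - (\<Union>m. B m) \<in> sets M" by measurable
    show "1 - exp (- 2 * a * b) \<le> prob (space M - (\<Union>m. B m))"
      using le by (subst prob_compl) auto
    fix \<omega> and t :: real assume \<omega>: "\<omega> \<in> space M - (\<Union>m. B m)" and t: "0 \<le> t"
    define q where "q m = real (nat \<lfloor>t * 2 ^ m\<rfloor>) * (1 / 2 ^ m)" for m :: nat
    have q_eq: "q m = of_int \<lfloor>t * 2 ^ m\<rfloor> / 2 ^ m" for m using t by (simp add: q_def)
    have q_le: "q m \<le> t" for m
      unfolding q_eq by (simp add: divide_le_eq)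
    have q_ge: "t - (1 / 2) ^ m \<le> q m" for m
    proof -
      have "t * 2 ^ m - 1 \<le> of_int \<lfloor>t * 2 ^ m\<rfloor>" by linarith
      hence "(t * 2 ^ m - 1) / 2 ^ m \<le> q m" unfolding q_eq by (rule divide_right_mono) simp
      thus ?thesis by (simp add: diff_divide_distrib power_divide)
    qed
    have q_nonneg: "0 \<le> q m" for m by (simp add: q_def)
    have q_lim: "q \<longlonglongrightarrow> t"
    proof (rule tendsto_sandwich[OF _ _ _ tendsto_const])
      show "(\<lambda>m. t - (1 / 2) ^ m) \<longlonglongrightarrow> t"
        using tendsto_diff[OF tendsto_const LIMSEQ_realpow_zero[of "1/2"], of t] by simp
    qed (use q_le q_ge in auto)
    have "continuous_on {0..} (\<lambda>t. W t \<omega>)" using BM \<omega> by (simp add: brownian_motion_def)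
    hence lim: "(\<lambda>m. W (q m) \<omega>) \<longlonglongrightarrow> W t \<omega>"
      by (rule continuous_on_tendsto_compose[OF _ q_lim]) (use t q_nonneg in auto)
    \<comment> \<open>Once t \<le> m, the time t rounded down to mesh 2^-m lies on the grid of level
      m, whose horizon is m.\<close>
    have "eventually (\<lambda>m. W (q m) \<omega> \<le> a + b * q m) sequentially"
    proof (rule eventually_sequentiallyI[of "nat \<lceil>t\<rceil>"])
      fix m assume "nat \<lceil>t\<rceil> \<le> m"
      hence "t \<le> real m" by linarith
      hence "t * 2 ^ m \<le> real (m * 2 ^ m)" by simp
      hence "nat \<lfloor>t * 2 ^ m\<rfloor> \<le> m * 2 ^ m" by (metis floor_mono floor_of_nat nat_int nat_mono)
      moreover have "\<omega> \<notin> B m" "\<omega> \<in> space M" using \<omega> by auto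
      ultimately show "W (q m) \<omega> \<le> a + b * q m" unfolding B_def q_def by force
    qed
    moreover have "(\<lambda>m. a + b * q m) \<longlonglongrightarrow> a + b * t" by (intro tendsto_intros q_lim)
    ultimately show "W t \<omega> \<le> a + b * t" using lim by (intro tendsto_le[OF sequentially_bot])
  qed
qed

section \<open>The theorem\<close>

lemma gevrey_imp_decays:
  assumes "in_H V0" "in_gevrey \<sigma> s \<phi> V0" "\<psi> < \<phi>" "0 < s" "0 \<le> \<sigma> * s"
  obtains R where "0 < R" "decays s \<psi> R V0"
proof -
  obtain C where C: "0 < C" "\<And>f G. f 0 = 0 \<Longrightarrow> 0 \<le> G \<Longrightarrow>
      (\<And>n. n \<noteq> 0 \<Longrightarrow> exp (\<phi> * knorm n powr s) * norm (f n) \<le> G) \<Longrightarrow> decays s \<psi> (G * C) f"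
    using exp_bound_imp_decays[OF assms(3,4)] by metis
  \<comment> \<open>Adding 1 to the norm keeps the constant positive also for V0 = 0.\<close>
  have "decays s \<psi> ((gnorm \<sigma> s \<phi> V0 + 1) * C) V0"
  proof (rule C(2))
    show "exp (\<phi> * knorm n powr s) * norm (V0 n) \<le> gnorm \<sigma> s \<phi> V0 + 1" if "n \<noteq> 0" for n
      using gevrey_mode_le_gnorm[OF assms(2) that assms(5)] by simp
  qed (use assms(1) gnorm_nonneg[of \<sigma> s \<phi> V0] in \<open>simp_all add: in_H_iff\<close>)
  moreover have "0 < (gnorm \<sigma> s \<phi> V0 + 1) * C"
    using C(1) gnorm_nonneg[of \<sigma> s \<phi> V0] by simp
  ultimately show ?thesis using that by blast
qed

theorem theorem3p5:
  fixes M :: "'a measure" and W :: "real \<Rightarrow> 'a \<Rightarrow> real"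
    and s \<sigma> \<eta> \<epsilon> :: real
  assumes BM: "brownian_motion M W"
    and hs: "4/5 < s" "s \<le> 1"
    and h\<sigma>: "8 / (5 * s) < \<sigma>" "\<sigma> < 2"
    and h\<eta>: "\<eta> > 0"
    and h\<epsilon>: "0 < \<epsilon>" "\<epsilon> < 1"
  shows "\<exists>\<alpha>>0. \<forall>V0. in_H V0 \<and> admissible V0 \<and> in_gevrey \<sigma> s (\<alpha> + \<eta>) V0 \<longrightarrow>
           (\<exists>\<nu>0>0. \<forall>\<nu>\<ge>\<nu>0.
              \<exists>A\<in>sets M. measure M A \<ge> 1 - \<epsilon> \<and>
                (\<forall>\<omega>\<in>A. \<exists>V. is_global_solution \<sigma> s \<eta> \<nu> (\<lambda>t. W t \<omega>) V0 V \<and>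
                    (\<forall>V'. is_global_solution \<sigma> s \<eta> \<nu> (\<lambda>t. W t \<omega>) V0 V' \<longrightarrow>
                       (\<forall>t\<ge>0. V' t = V t))))"
proof -
  have s: "0 < s" "1/2 \<le> s" "1/2 < s" using hs by auto
  have "0 < 8 / (5 * s)" using s by simp
  hence \<sigma>: "0 < \<sigma>" using h\<sigma> by linarith
  have \<sigma>s: "0 \<le> \<sigma> * s" "\<sigma> * s \<le> 2"
    using \<sigma> s hs h\<sigma> mult_mono[of \<sigma> 2 s 1] by auto
  \<comment> \<open>Chosen so that exp(- \<alpha> / 4) = \<epsilon>.\<close>
  define \<alpha> where "\<alpha> = 4 * ln (1 / \<epsilon>)"
  have \<alpha>: "0 < \<alpha>" using h\<epsilon> by (simp add: \<alpha>_def ln_div)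
  have prob: "exp (- 2 * (\<alpha> / 2 / \<nu>) * (\<nu> / 4)) = \<epsilon>" if "0 < \<nu>" for \<nu>
  proof -
    have "- 2 * (\<alpha> / 2 / \<nu>) * (\<nu> / 4) = ln \<epsilon>"
      using that h\<epsilon> by (simp add: \<alpha>_def ln_div)
    thus ?thesis using h\<epsilon> by simp
  qed
  show ?thesis
  proof (rule exI[of _ \<alpha>], intro conjI \<alpha> allI impI, elim conjE)
    fix V0 assume V0: "in_H V0" "admissible V0" "in_gevrey \<sigma> s (\<alpha> + \<eta>) V0"
    obtain R where R: "0 < R" "decays s (\<eta> + \<alpha> / 2) R V0"
      using gevrey_imp_decays[OF V0(1,3) _ s(1) \<sigma>s(1), of "\<eta> + \<alpha> / 2"] \<alpha> by auto
    \<comment> \<open>The summand 1 gives \<nu> \<ge> 1, hence \<nu> \<le> \<nu>^2, which turns this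
      linear threshold into the quadratic condition \<open>large\<close>. The initial datum enters
      through R.\<close>
    define \<nu>0 where "\<nu>0 = 1 + 81920 * knorm_sum * R"
    have \<nu>0: "1 \<le> \<nu>0" using R(1) knorm_sum_nonneg by (simp add: \<nu>0_def)
    show "\<exists>\<nu>0>0. \<forall>\<nu>\<ge>\<nu>0. \<exists>A\<in>sets M. measure M A \<ge> 1 - \<epsilon> \<and>
        (\<forall>\<omega>\<in>A. \<exists>V. is_global_solution \<sigma> s \<eta> \<nu> (\<lambda>t. W t \<omega>) V0 V \<and>
            (\<forall>V'. is_global_solution \<sigma> s \<eta> \<nu> (\<lambda>t. W t \<omega>) V0 V' \<longrightarrow> (\<forall>t\<ge>0. V' t = V t)))"
    proof (intro exI[of _ \<nu>0] conjI allI impI)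
      show "0 < \<nu>0" using \<nu>0 by simp
      fix \<nu> assume \<nu>: "\<nu>0 \<le> \<nu>"
      hence \<nu>pos: "0 < \<nu>" using \<nu>0 by linarith
      have "\<nu> * 1 \<le> \<nu> * \<nu>" using \<nu> \<nu>0 by (intro mult_left_mono) auto
      hence large: "81920 * knorm_sum * R \<le> \<nu>\<^sup>2" using \<nu> unfolding \<nu>0_def power2_eq_square by linarith
      obtain A where A: "A \<in> sets M" "measure M A \<ge> 1 - exp (- 2 * (\<alpha> / 2 / \<nu>) * (\<nu> / 4))"
        "\<And>\<omega> t. \<omega> \<in> A \<Longrightarrow> 0 \<le> t \<Longrightarrow> W t \<omega> \<le> \<alpha> / 2 / \<nu> + \<nu> / 4 * t"
        using brownian_linear_bound[OF BM, of "\<alpha> / 2 / \<nu>" "\<nu> / 4"] \<alpha> \<nu>pos by auto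
      show "\<exists>A\<in>sets M. measure M A \<ge> 1 - \<epsilon> \<and>
        (\<forall>\<omega>\<in>A. \<exists>V. is_global_solution \<sigma> s \<eta> \<nu> (\<lambda>t. W t \<omega>) V0 V \<and>
            (\<forall>V'. is_global_solution \<sigma> s \<eta> \<nu> (\<lambda>t. W t \<omega>) V0 V' \<longrightarrow> (\<forall>t\<ge>0. V' t = V t)))"
      proof (intro bexI[of _ A] conjI ballI A(1))
        show "1 - \<epsilon> \<le> measure M A" using A(2) unfolding prob[OF \<nu>pos] .
        fix \<omega> assume \<omega>: "\<omega> \<in> A"
        hence "\<omega> \<in> space M" using A(1) sets.sets_into_space by blast
        hence W: "W 0 \<omega> = 0" "continuous_on {0..} (\<lambda>t. W t \<omega>)"
          using BM unfolding brownian_motion_def by blast+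
        interpret path: subcritical_path s \<eta> "\<alpha> / 2" \<nu> R "\<lambda>t. W t \<omega>" V0
        proof
          fix t :: real assume "0 \<le> t"
          hence "\<nu> * W t \<omega> \<le> \<nu> * (\<alpha> / 2 / \<nu> + \<nu> / 4 * t)" using A(3) \<omega> \<nu>pos by (intro mult_left_mono) auto
          also have "\<dots> = \<alpha> / 2 + \<nu>\<^sup>2 / 4 * t" using \<nu>pos by (simp add: field_simps power2_eq_square)
          finally show "\<nu> * W t \<omega> \<le> \<alpha> / 2 + \<nu>\<^sup>2 / 4 * t" .
        qed (use s hs h\<eta> \<nu>pos R W V0 large in \<open>simp_all add: admissible_iff_symmetric in_H_iff\<close>)
        obtain V where V: "is_global_solution \<sigma> s \<eta> \<nu> (\<lambda>t. W t \<omega>) V0 V"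
          using path.global_solution_exists[OF \<sigma>s] by blast
        moreover have "V' t = V t" if "is_global_solution \<sigma> s \<eta> \<nu> (\<lambda>t. W t \<omega>) V0 V'" "0 \<le> t" for V' t
          by (rule global_solution_unique[OF that(1) V W(2) s(3) hs(2) \<sigma> h\<eta> \<nu>pos that(2)])
        ultimately show "\<exists>V. is_global_solution \<sigma> s \<eta> \<nu> (\<lambda>t. W t \<omega>) V0 V \<and>
            (\<forall>V'. is_global_solution \<sigma> s \<eta> \<nu> (\<lambda>t. W t \<omega>) V0 V' \<longrightarrow> (\<forall>t\<ge>0. V' t = V t))" by blast
      qed
    qed
  qed
qed

end
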